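(* Let $u,v$ be independent, each uniformly distributed on $S_n$. Then there is a constant $c\in[1,\pi^2/6]$ such that, as $n\to\infty$, \[\mathbb E[\mathrm{FS}(u,v)]=2n-2\ln n-2\gamma+c+o(1),\] where $\gamma$ is the Euler–Mascheroni constant, and \[\frac{\mathrm{FS}(u,v)-(2n-2\ln n)}{\sqrt{2\ln n}}\xrightarrow{d}\mathcal N(0,1).\]
   Context: Let $S_{\mathbb Z_+}$ be the group of permutations of the positive integers fixing all but finitely many points; $S_n\subset S_{\mathbb Z_+}$ by letting $w\in S_n$ fix every $j>n$. For $w\in S_{\mathbb Z_+}$ let $\mathrm{FS}(w)=\min\{n\ge1: w\in S_n\}$. For $j\ge1$ let $\chi_j(w)=1$ if there exists $k<j$ with $w(k)>w(j)$ and $\chi_j(w)=0$ otherwise, and let $\Lambda_i(w)=\sum_{j\ge i}\chi_j(w)$ (a finite sum). For $u,v\in S_{\mathbb Z_+}$, $\mathrm{FS}(u,v)$ (the forward stability of the Schubert product $\mathfrak S_u\mathfrak S_v$) is the smallest $m$ such that every permutation $w$ with nonzero Schubert structure constant $c^w_{u,v}$ (defined by $\mathfrak S_u\mathfrak S_v=\sum_w c^w_{u,v}\mathfrak S_w$) lies in $S_m$. It is known (Hardt–Wallach) that \[\mathrm{FS}(u,v)=\max_{1\le i\le 1+\max(\mathrm{FS}(u),\mathrm{FS}(v))}\big(\Lambda_i(u)+\Lambda_i(v)+i-1\big).\] $\xrightarrow{d}$ denotes convergence in distribution and $\mathcal N(0,1)$ the standard normal law. *)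

theory Defs
  imports
    "HOL-Probability.Probability"
    "HOL-Combinatorics.Permutations"
    "HOL-Library.Poly_Mapping"
    "HOL-Library.Landau_Symbols"
begin

text \<open>
  Permutations of the positive integers are functions on \<^typ>\<open>nat\<close> that fix \<open>0\<close>.
\<close>

definition Sn :: "nat \<Rightarrow> (nat \<Rightarrow> nat) set" where
  "Sn n = {w. w permutes {1..n}}"

definition Sinf :: "(nat \<Rightarrow> nat) set" where
  "Sinf = (\<Union>n. Sn n)"

text \<open>
  The ring \<open>\<int>[x\<^sub>1, x\<^sub>2, \<dots>]\<close>: finitely supported maps from exponent vectors to integer
  coefficients, with the convolution product. The variable of index \<open>0\<close> is never used.
\<close>

type_synonym mpoly = "(nat \<Rightarrow>\<^sub>0 nat) \<Rightarrow>\<^sub>0 int"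

definition X :: "nat \<Rightarrow> mpoly" where
  "X i = Poly_Mapping.single (Poly_Mapping.single i 1) 1"

text \<open>
  Exchange of \<open>x\<^sub>i\<close> and \<open>x\<^bsub>i+1\<^esub>\<close>. The inner \<^const>\<open>Poly_Mapping.map_key\<close> permutes an exponent
  vector; the outer one reads off the coefficient of \<open>m\<close> in the result as the coefficient of the
  permuted \<open>m\<close> in \<open>f\<close>. As the transposition is an involution, no inverse is needed.
\<close>

definition swap_vars :: "nat \<Rightarrow> mpoly \<Rightarrow> mpoly" where
  "swap_vars i f = Poly_Mapping.map_key (Poly_Mapping.map_key (Transposition.transpose i (Suc i))) f"

text \<open>
  The divided difference \<open>(f - s\<^sub>i f) / (x\<^sub>i - x\<^bsub>i+1\<^esub>)\<close>; the quotient is a polynomial, and it is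
  unique because \<^typ>\<open>mpoly\<close> is an integral domain.
\<close>

definition divided_diff :: "nat \<Rightarrow> mpoly \<Rightarrow> mpoly" where
  "divided_diff i f = (THE g. (X i - X (Suc i)) * g = f - swap_vars i f)"

definition longest_perm :: "nat \<Rightarrow> nat \<Rightarrow> nat" where
  "longest_perm n j = (if 1 \<le> j \<and> j \<le> n then n + 1 - j else j)"

text \<open>
  Schubert polynomials after Lascoux and Schuetzenberger: start from the staircase monomial
  \<open>x\<^sub>1\<^bsup>n-1\<^esup> x\<^sub>2\<^bsup>n-2\<^esup> \<dots> x\<^bsub>n-1\<^esub>\<close> for the longest element of \<^term>\<open>Sn n\<close> and apply \<^const>\<open>divided_diff\<close>
  at descents. The result depends neither on \<open>n\<close> nor on the chosen sequence of descents, so the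
  relation below is the graph of a function on \<^const>\<open>Sinf\<close>.
\<close>

inductive is_schubert :: "(nat \<Rightarrow> nat) \<Rightarrow> mpoly \<Rightarrow> bool" where
  longest: "is_schubert (longest_perm n) (\<Prod>i=1..n. X i ^ (n - i))"
| descent: "is_schubert (w \<circ> Transposition.transpose i (Suc i)) (divided_diff i p)"
    if "is_schubert w p" "1 \<le> i" "w i > w (Suc i)"

definition schubert :: "(nat \<Rightarrow> nat) \<Rightarrow> mpoly" where
  "schubert w = (THE p. is_schubert w p)"

text \<open>
  The structure constants \<open>c\<^sup>w\<^sub>u\<^sub>v\<close> as a function of \<open>w\<close>: the coordinates of the product in the
  \<open>\<int>\<close>-basis of Schubert polynomials, extended by \<open>0\<close> outside \<^const>\<open>Sinf\<close>.
\<close>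

definition schubert_coeff :: "(nat \<Rightarrow> nat) \<Rightarrow> (nat \<Rightarrow> nat) \<Rightarrow> (nat \<Rightarrow> nat) \<Rightarrow> int" where
  "schubert_coeff u v = (THE c. finite {w. c w \<noteq> 0} \<and> {w. c w \<noteq> 0} \<subseteq> Sinf \<and>
     schubert u * schubert v = (\<Sum>w\<in>{w. c w \<noteq> 0}. of_int (c w) * schubert w))"

text \<open>
  The bound \<open>m \<ge> 1\<close> only matters for \<open>u = v = id\<close>, because \<^term>\<open>Sn 0 = Sn 1\<close>.
\<close>

definition FS :: "(nat \<Rightarrow> nat) \<Rightarrow> (nat \<Rightarrow> nat) \<Rightarrow> nat" where
  "FS u v = (LEAST m. m \<ge> 1 \<and> (\<forall>w. schubert_coeff u v w \<noteq> 0 \<longrightarrow> w \<in> Sn m))"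

text \<open>The joint law of two independent uniformly distributed elements of \<^term>\<open>Sn n\<close>.\<close>

definition unif_pair :: "nat \<Rightarrow> ((nat \<Rightarrow> nat) \<times> (nat \<Rightarrow> nat)) pmf" where
  "unif_pair n = pair_pmf (pmf_of_set (Sn n)) (pmf_of_set (Sn n))"

end

theory Submission
  imports Defs "HOL-Real_Asymp.Real_Asymp"
begin

text \<open>
  The Schubert polynomials of \<open>S\<^sub>m\<close> form a \<open>\<int>\<close>-basis of the polynomials whose exponents satisfy
  \<open>a\<^sub>j \<le> m - j\<close>. Hence \<open>FS u v\<close> is the least \<open>m\<close> with
  \<open>deg\<^sub>j \<SS>\<^sub>u + deg\<^sub>j \<SS>\<^sub>v \<le> m - j\<close> for all \<open>j\<close>, where \<open>deg\<^sub>j\<close> is the degree in \<open>x\<^sub>j\<close>.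
  Writing \<open>f = s\<^sub>j f + (x\<^sub>j - x\<^bsub>j+1\<^esub>) \<partial>\<^sub>j f\<close> and inducting downwards on \<open>j\<close>, one finds
  \<open>deg\<^sub>j \<SS>\<^sub>w \<le> \<Lambda>\<^bsub>j+1\<^esub>(w)\<close>, with equality if \<open>w\<close> has a record (left-to-right maximum) at \<open>j\<close>.
  The first \<open>i\<close> that maximises \<open>\<Lambda>\<^bsub>i+1\<^esub>(u) + \<Lambda>\<^bsub>i+1\<^esub>(v) + i\<close> is a record of both permutations, which
  gives the Hardt-Wallach formula unless \<open>u\<close> and \<open>v\<close> both fix \<open>n\<close>.

  The maximum equals \<open>2n - R(u) - R(v) + M\<^sub>n\<close>, where \<open>R\<close> counts records and \<open>M\<^sub>n\<close> is the maximum
  of a walk that steps up only at common records. Records at different positions are independent,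
  with probability \<open>1/j\<close> at \<open>j\<close>; so \<open>R\<close> has mean \<open>H\<^sub>n\<close>, the expectation of \<open>M\<^sub>n\<close> increases to a
  limit in \<open>[1, \<Sum>1/j\<^sup>2]\<close>, and the characteristic function of \<open>R\<close> is
  \<open>\<Prod>\<^sub>j (1 + (z - 1)/j) \<approx> exp ((z - 1) H\<^sub>n)\<close> with \<open>z\<close> on the unit circle near \<open>1\<close>.
\<close>

subsection \<open>Divided differences and degrees in one variable\<close>

abbreviation adj :: "nat \<Rightarrow> nat \<Rightarrow> nat" where
  "adj i \<equiv> Transposition.transpose i (Suc i)"

section \<open>Exchange of adjacent variables as a ring automorphism\<close>

lemma map_key_adj_single [simp]:
  "Poly_Mapping.map_key (adj i) (Poly_Mapping.single k v) = Poly_Mapping.single (adj i k) v"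
  by (metis Poly_Mapping.map_key_single bij_transpose bij_is_inj transpose_involutory)

lemma map_key_adj_involutory [simp]:
  "Poly_Mapping.map_key (adj i) (Poly_Mapping.map_key (adj i) m) = m"
  by (simp add: Poly_Mapping.map_key_compose o_def Poly_Mapping.map_key_id)

lemma inj_map_key_adj: "inj (Poly_Mapping.map_key (adj i))"
  by (metis injI map_key_adj_involutory)

lemma lookup_swap_vars:
  "Poly_Mapping.lookup (swap_vars i f) m = Poly_Mapping.lookup f (Poly_Mapping.map_key (adj i) m)"
  unfolding swap_vars_def by (simp add: Poly_Mapping.map_key.rep_eq inj_map_key_adj)

lemma lookup_map_key_adj:
  "Poly_Mapping.lookup (Poly_Mapping.map_key (adj i) m) j = Poly_Mapping.lookup m (adj i j)"
  by (simp add: Poly_Mapping.map_key.rep_eq)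

lemma swap_vars_diff: "swap_vars i (f - g) = swap_vars i f - swap_vars i g"
  by (rule poly_mapping_eqI) (simp add: lookup_swap_vars lookup_minus)

lemma swap_vars_add: "swap_vars i (f + g) = swap_vars i f + swap_vars i g"
  by (rule poly_mapping_eqI) (simp add: lookup_swap_vars lookup_add)

lemma swap_vars_zero [simp]: "swap_vars i 0 = 0"
  by (rule poly_mapping_eqI) (simp add: lookup_swap_vars)

lemma swap_vars_involutory [simp]: "swap_vars i (swap_vars i f) = f"
  by (rule poly_mapping_eqI) (simp add: lookup_swap_vars)

lemma swap_vars_single [simp]:
  "swap_vars i (Poly_Mapping.single m c) = Poly_Mapping.single (Poly_Mapping.map_key (adj i) m) c"
  unfolding swap_vars_def by (metis inj_map_key_adj Poly_Mapping.map_key_single map_key_adj_involutory)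

text \<open>The type \<open>mpoly\<close> is the free abelian group on the exponent vectors, so an
  additive claim only has to be checked on monomials with coefficient 1.\<close>

lemma frag_induct_UNIV [case_names zero one diff]:
  assumes "P 0" "\<And>x. P (frag_of x)" "\<And>a b. P a \<Longrightarrow> P b \<Longrightarrow> P (a - b)"
  shows "P c"
  by (rule frag_induction[where S = UNIV]) (use assms in auto)

lemma swap_vars_mult: "swap_vars i (f * g) = swap_vars i f * swap_vars i g"
proof (induction f rule: frag_induct_UNIV)
  case (one x)
  show ?case
    by (induction g rule: frag_induct_UNIV)
       (simp_all add: swap_vars_diff right_diff_distrib mult_single
          Poly_Mapping.map_key_plus)
qed (simp_all add: swap_vars_diff left_diff_distrib)

lemma swap_vars_one [simp]: "swap_vars i 1 = 1"
  using swap_vars_single[of i 0 1] by (simp del: swap_vars_single add: swap_vars_single)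

lemma swap_vars_X [simp]: "swap_vars i (X j) = X (adj i j)"
  by (simp add: X_def)

lemma swap_vars_of_int [simp]: "swap_vars i (of_int c) = of_int c"
  by (simp flip: Poly_Mapping.single_of_int)

lemma swap_vars_power: "swap_vars i (f ^ k) = swap_vars i f ^ k"
  by (induction k) (simp_all add: swap_vars_mult)

lemma swap_vars_prod: "swap_vars i (prod f A) = (\<Prod>x\<in>A. swap_vars i (f x))"
  by (induction A rule: infinite_finite_induct) (simp_all add: swap_vars_mult)

lemma swap_vars_comm:
  assumes "Suc i < j"
  shows "swap_vars i (swap_vars j f) = swap_vars j (swap_vars i f)"
proof -
  have "adj j \<circ> adj i = adj i \<circ> adj j"
    using assms by (auto simp: fun_eq_iff Transposition.transpose_def)
  then show ?thesis
    by (intro poly_mapping_eqI) (simp add: lookup_swap_vars Poly_Mapping.map_key_compose)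
qed

lemma swap_vars_braid:
  "swap_vars i (swap_vars (Suc i) (swap_vars i f)) = swap_vars (Suc i) (swap_vars i (swap_vars (Suc i) f))"
proof -
  have "adj i \<circ> adj (Suc i) \<circ> adj i = adj (Suc i) \<circ> adj i \<circ> adj (Suc i)"
    by (auto simp: fun_eq_iff Transposition.transpose_def)
  then show ?thesis
    by (intro poly_mapping_eqI)
       (simp add: lookup_swap_vars Poly_Mapping.map_key_compose inj_compose comp_assoc)
qed

section \<open>Monomials and induction over polynomials\<close>

definition monom_of :: "(nat \<Rightarrow>\<^sub>0 nat) \<Rightarrow> mpoly" where
  "monom_of m = Poly_Mapping.single m 1"

lemma monom_of_mult: "monom_of (m + k) = monom_of m * monom_of k"
  by (simp add: monom_of_def mult_single)

text \<open>Induction on the total degree: a nonzero exponent vector has a positive entry, and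
  lowering it by one lowers the sum of all entries.\<close>

lemma exponent_induct [case_names zero add]:
  fixes m :: "nat \<Rightarrow>\<^sub>0 nat"
  assumes "P 0" "\<And>i m. P m \<Longrightarrow> P (Poly_Mapping.single i 1 + m)"
  shows "P m"
proof (induction "\<Sum>i\<in>Poly_Mapping.keys m. Poly_Mapping.lookup m i" arbitrary: m rule: less_induct)
  case less
  show ?case
  proof (cases "m = 0")
    case False
    then obtain i where i: "i \<in> Poly_Mapping.keys m"
      by (metis in_keys_iff lookup_zero poly_mapping_eqI)
    define k where "k = m - Poly_Mapping.single i 1"
    have m: "m = Poly_Mapping.single i 1 + k"
      using i by (auto intro!: poly_mapping_eqI
          simp: k_def lookup_add lookup_minus lookup_single when_def in_keys_iff)
    have "(\<Sum>j\<in>Poly_Mapping.keys k. Poly_Mapping.lookup k j)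
        \<le> (\<Sum>j\<in>Poly_Mapping.keys m. Poly_Mapping.lookup k j)"
      by (rule sum_mono2) (auto simp: k_def in_keys_iff lookup_minus)
    also have "\<dots> < (\<Sum>j\<in>Poly_Mapping.keys m. Poly_Mapping.lookup m j)"
      by (rule sum_strict_mono_ex1)
         (use i in \<open>auto simp: k_def lookup_minus lookup_single in_keys_iff intro!: bexI[of _ i]\<close>)
    finally show ?thesis
      using less assms(2) m by metis
  qed (use assms(1) in simp)
qed

lemma mpoly_induct [case_names zero one X_mult diff]:
  assumes "P 0" "P 1" "\<And>i f. P f \<Longrightarrow> P (X i * f)" "\<And>f g. P f \<Longrightarrow> P g \<Longrightarrow> P (f - g)"
  shows "P (f :: mpoly)"
proof (induction f rule: frag_induct_UNIV)
  case (one m)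
  show ?case
  proof (induction m rule: exponent_induct)
    case (add i m)
    then show ?case using assms(3)[of "frag_of m" i] by (simp add: X_def mult_single)
  qed (use assms(2) in simp)
qed (use assms in auto)

section \<open>The degree in one variable\<close>

definition degv :: "nat \<Rightarrow> mpoly \<Rightarrow> nat" where
  "degv i f = Max (insert 0 ((\<lambda>m. Poly_Mapping.lookup m i) ` Poly_Mapping.keys f))"

lemma degv_le_iff: "degv i f \<le> d \<longleftrightarrow> (\<forall>m\<in>Poly_Mapping.keys f. Poly_Mapping.lookup m i \<le> d)"
  by (simp add: degv_def)

lemma lookup_le_degv: "m \<in> Poly_Mapping.keys f \<Longrightarrow> Poly_Mapping.lookup m i \<le> degv i f"
  using degv_le_iff by blast

text \<open>This convention for the zero polynomial is the reason why \<open>degv_mult\<close> and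
  its applications ask for nonzero polynomials.\<close>

lemma degv_zero [simp]: "degv i 0 = 0"
  by (simp add: degv_def)

lemma degv_attained:
  assumes "f \<noteq> 0"
  obtains m where "m \<in> Poly_Mapping.keys f" "Poly_Mapping.lookup m i = degv i f"
proof -
  have "Poly_Mapping.keys f \<noteq> {}" using assms by simp
  moreover have "degv i f \<in> insert 0 ((\<lambda>m. Poly_Mapping.lookup m i) ` Poly_Mapping.keys f)"
    unfolding degv_def by (rule Max_in) auto
  ultimately show thesis
    using that lookup_le_degv by (smt (verit, best) all_not_in_conv imageE insertE le_zero_eq)
qed

lemma degv_single [simp]:
  "c \<noteq> 0 \<Longrightarrow> degv i (Poly_Mapping.single m c) = Poly_Mapping.lookup m i"
  by (simp add: degv_def)

lemma degv_one [simp]: "degv i 1 = 0"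
  using degv_single[of 1 i 0] by simp

lemma degv_of_int [simp]: "degv i (of_int c) = 0"
  by (cases "c = 0") (use degv_single[of c i 0] in \<open>simp_all flip: Poly_Mapping.single_of_int\<close>)

lemma degv_X: "degv i (X j) = (if i = j then 1 else 0)"
  by (simp add: X_def lookup_single)

lemma degv_add_le: "degv i (f + g) \<le> max (degv i f) (degv i g)"
  unfolding degv_le_iff
proof
  fix m assume "m \<in> Poly_Mapping.keys (f + g)"
  then have "m \<in> Poly_Mapping.keys f \<or> m \<in> Poly_Mapping.keys g"
    using Poly_Mapping.keys_add[of f g] by blast
  then show "Poly_Mapping.lookup m i \<le> max (degv i f) (degv i g)"
    using lookup_le_degv by (metis le_max_iff_disj)
qed

lemma degv_uminus [simp]: "degv i (- f) = degv i f"
  by (simp add: degv_def)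

lemma degv_diff_le: "degv i (f - g) \<le> max (degv i f) (degv i g)"
  using degv_add_le[of i f "- g"] by simp

lemma degv_add_eq_left:
  assumes "degv i g < degv i f"
  shows "degv i (f + g) = degv i f"
proof (rule antisym)
  show "degv i f \<le> degv i (f + g)"
    using degv_diff_le[of i "f + g" g] assms by (auto simp: le_max_iff_disj)
qed (use degv_add_le[of i f g] assms in simp)

lemma degv_mult_le: "degv i (f * g) \<le> degv i f + degv i g"
  unfolding degv_le_iff
proof
  fix m assume "m \<in> Poly_Mapping.keys (f * g)"
  then obtain a b where "m = a + b" "a \<in> Poly_Mapping.keys f" "b \<in> Poly_Mapping.keys g"
    using Poly_Mapping.keys_mult[of f g] by auto
  then show "Poly_Mapping.lookup m i \<le> degv i f + degv i g"
    by (simp add: lookup_add add_mono lookup_le_degv)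
qed

lemma degv_sum_le: "(\<And>x. x \<in> A \<Longrightarrow> degv i (f x) \<le> d) \<Longrightarrow> degv i (sum f A) \<le> d"
proof (induction A rule: infinite_finite_induct)
  case (insert x F)
  then show ?case using degv_add_le[of i "f x" "sum f F"] by fastforce
qed auto

lemma degv_swap_vars: "degv j (swap_vars i f) = degv (adj i j) f"
proof -
  have le: "degv j (swap_vars i f) \<le> degv (adj i j) f" for f j
    unfolding degv_le_iff
  proof
    fix m assume "m \<in> Poly_Mapping.keys (swap_vars i f)"
    then have "Poly_Mapping.map_key (adj i) m \<in> Poly_Mapping.keys f"
      by (simp add: in_keys_iff lookup_swap_vars)
    then show "Poly_Mapping.lookup m j \<le> degv (adj i j) f"
      using lookup_le_degv[of _ f "adj i j"] by (metis lookup_map_key_adj transpose_involutory)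
  qed
  show ?thesis
    using le[of j f] le[of "adj i j" "swap_vars i f"] by simp
qed

definition xpart :: "nat \<Rightarrow> nat \<Rightarrow> mpoly \<Rightarrow> mpoly" where
  "xpart i d f = (\<Sum>m\<in>{m\<in>Poly_Mapping.keys f. Poly_Mapping.lookup m i = d}.
      Poly_Mapping.single m (Poly_Mapping.lookup f m))"

lemma lookup_xpart:
  "Poly_Mapping.lookup (xpart i d f) m = (if Poly_Mapping.lookup m i = d then Poly_Mapping.lookup f m else 0)"
proof -
  have "Poly_Mapping.lookup (xpart i d f) m =
     (\<Sum>k\<in>{k\<in>Poly_Mapping.keys f. Poly_Mapping.lookup k i = d}. if k = m then Poly_Mapping.lookup f k else 0)"
    by (simp add: xpart_def lookup_sum lookup_single when_def)
  then show ?thesis by (simp add: in_keys_iff sum.delta)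
qed

text \<open>The product of the leading parts in x_i is nonzero because \<open>mpoly\<close> is an
  integral domain, and all its monomials have x_i-exponent \<open>?d\<close>. The remaining part of
  \<open>f * g\<close> has smaller degree in x_i, so the top degree cannot cancel.\<close>

lemma degv_mult:
  assumes "f \<noteq> 0" "g \<noteq> 0"
  shows "degv i (f * g) = degv i f + degv i g"
proof (rule antisym[OF degv_mult_le], rule ccontr)
  let ?F = "xpart i (degv i f) f" and ?G = "xpart i (degv i g) g"
  let ?d = "degv i f + degv i g"
  assume "\<not> degv i f + degv i g \<le> degv i (f * g)"
  then have lt: "degv i (f * g) < ?d" by simp
  have nz: "xpart i (degv i h) h \<noteq> 0" if "h \<noteq> 0" for h
  proof -
    obtain m where "m \<in> Poly_Mapping.keys h" "Poly_Mapping.lookup m i = degv i h"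
      using degv_attained \<open>h \<noteq> 0\<close> by blast
    then have "Poly_Mapping.lookup (xpart i (degv i h) h) m \<noteq> 0"
      by (simp add: lookup_xpart in_keys_iff)
    then show ?thesis by force
  qed
  have small: "degv i (h - xpart i (degv i h) h) \<le> degv i h - 1"
    if "degv i h > 0" for h
    unfolding degv_le_iff
  proof
    fix m assume "m \<in> Poly_Mapping.keys (h - xpart i (degv i h) h)"
    then have "m \<in> Poly_Mapping.keys h" "Poly_Mapping.lookup m i \<noteq> degv i h"
      by (auto simp: in_keys_iff lookup_minus lookup_xpart split: if_splits)
    then show "Poly_Mapping.lookup m i \<le> degv i h - 1"
      using lookup_le_degv[of m h i] by linarith
  qed
  \<comment> \<open>In degree 0 the bound \<open>degv i h - 1\<close> is truncated and gives no
    strict decrease; the remainder vanishes instead.\<close>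
  have full: "h - xpart i (degv i h) h = 0" if "degv i h = 0" for h
  proof (rule poly_mapping_eqI)
    fix m
    show "Poly_Mapping.lookup (h - xpart i (degv i h) h) m = Poly_Mapping.lookup 0 m"
      using that lookup_le_degv[of m h i]
      by (cases "Poly_Mapping.lookup h m = 0") (simp_all add: lookup_minus lookup_xpart in_keys_iff)
  qed
  have degF: "degv i ?F \<le> degv i f" "degv i ?G \<le> degv i g"
    by (auto simp: degv_le_iff in_keys_iff lookup_xpart split: if_splits)
  have "f * g - ?F * ?G = (f - ?F) * g + ?F * (g - ?G)"
    by (simp add: algebra_simps)
  moreover have "degv i ((f - ?F) * g) < ?d"
  proof (cases "degv i f = 0")
    case True
    then show ?thesis unfolding full[OF True] using lt by simp
  next
    case False
    then show ?thesis using degv_mult_le[of i "f - ?F" g] small[of f] by linarith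
  qed
  moreover have "degv i (?F * (g - ?G)) < ?d"
  proof (cases "degv i g = 0")
    case True
    then show ?thesis unfolding full[OF True] using lt by simp
  next
    case False
    then show ?thesis using degv_mult_le[of i ?F "g - ?G"] small[of g] degF by linarith
  qed
  ultimately have "degv i (f * g - ?F * ?G) < ?d"
    using degv_add_le[of i "(f - ?F) * g" "?F * (g - ?G)"] by (simp only:)
  then have FG: "degv i (?F * ?G) < ?d"
    using lt degv_diff_le[of i "f * g" "f * g - ?F * ?G"] by simp
  have "?F * ?G \<noteq> 0" using nz assms by simp
  then obtain m where m: "m \<in> Poly_Mapping.keys (?F * ?G)" by force
  then obtain a b where ab: "m = a + b" "a \<in> Poly_Mapping.keys ?F" "b \<in> Poly_Mapping.keys ?G"
    using Poly_Mapping.keys_mult[of ?F ?G] by blast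
  have xp: "Poly_Mapping.lookup a i = e" if "a \<in> Poly_Mapping.keys (xpart i e h)" for a e h
    using that by (simp add: in_keys_iff lookup_xpart split: if_splits)
  have "Poly_Mapping.lookup m i = ?d"
    unfolding ab(1) lookup_add xp[OF ab(2)] xp[OF ab(3)] ..
  then show False using FG lookup_le_degv[OF m, of i] by linarith
qed

section \<open>Divided differences and their relations\<close>

lemma X_diff_neq_0: "X i - X (Suc i) \<noteq> 0"
proof
  assume "X i - X (Suc i) = 0"
  then have "degv i (X i) = degv i (X (Suc i))" by simp
  then show False by (simp add: degv_X)
qed

text \<open>For a product with x_j the quotient comes from the twisted Leibniz rule: the divided
  difference of x_j f is that of x_j times f, plus the exchanged x_j times that of f.\<close>

lemma divided_diff_exists: "\<exists>g. (X i - X (Suc i)) * g = f - swap_vars i f"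
proof (induction f rule: mpoly_induct)
  case (X_mult j f)
  then obtain g where g: "(X i - X (Suc i)) * g = f - swap_vars i f" by blast
  have "\<exists>h. (X i - X (Suc i)) * h = X j - X (adj i j)"
  proof -
    consider "j = i" | "j = Suc i" | "j \<noteq> i" "j \<noteq> Suc i" by blast
    then show ?thesis
    proof cases
      case 2
      then show ?thesis by (auto intro!: exI[of _ "-1"])
    qed (auto intro: exI[of _ 1] exI[of _ 0])
  qed
  then obtain h where h: "(X i - X (Suc i)) * h = X j - X (adj i j)" by blast
  have "(X i - X (Suc i)) * (h * f + X (adj i j) * g)
      = (X i - X (Suc i)) * h * f + X (adj i j) * ((X i - X (Suc i)) * g)"
    by (simp add: algebra_simps)
  also have "\<dots> = X j * f - swap_vars i (X j * f)"
    unfolding g h by (simp add: swap_vars_mult algebra_simps)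
  finally show ?case by blast
next
  case (diff f g)
  then obtain a b where "(X i - X (Suc i)) * a = f - swap_vars i f"
     "(X i - X (Suc i)) * b = g - swap_vars i g" by blast
  then have "(X i - X (Suc i)) * (a - b) = (f - swap_vars i f) - (g - swap_vars i g)"
    by (simp only: right_diff_distrib)
  also have "\<dots> = (f - g) - swap_vars i (f - g)"
    by (simp add: swap_vars_diff)
  finally show ?case by blast
qed (auto intro: exI[of _ 0])

lemma divided_diff_eqI:
  assumes "(X i - X (Suc i)) * g = f - swap_vars i f"
  shows "divided_diff i f = g"
  unfolding divided_diff_def
proof (rule the_equality)
  fix h assume "(X i - X (Suc i)) * h = f - swap_vars i f"
  then show "h = g" using assms X_diff_neq_0[of i] by (metis mult_left_cancel)
qed (fact assms)

lemma divided_diff_spec: "(X i - X (Suc i)) * divided_diff i f = f - swap_vars i f"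
  using divided_diff_exists[of i f] divided_diff_eqI by metis

lemma divided_diff_eq_0_iff: "divided_diff i f = 0 \<longleftrightarrow> swap_vars i f = f"
  using divided_diff_spec[of i f] X_diff_neq_0[of i] by (metis eq_iff_diff_eq_0 mult_eq_0_iff)

lemma divided_diff_zero [simp]: "divided_diff i 0 = 0"
  by (simp add: divided_diff_eq_0_iff)

lemma divided_diff_add: "divided_diff i (f + g) = divided_diff i f + divided_diff i g"
  by (rule divided_diff_eqI) (simp add: distrib_left divided_diff_spec swap_vars_add)

lemma divided_diff_mult_of_sym:
  "swap_vars i g = g \<Longrightarrow> divided_diff i (g * f) = g * divided_diff i f"
  by (rule divided_diff_eqI)
     (metis divided_diff_spec mult.left_commute right_diff_distrib swap_vars_mult)

lemma divided_diff_of_int_mult: "divided_diff i (of_int c * f) = of_int c * divided_diff i f"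
  by (simp add: divided_diff_mult_of_sym)

lemma divided_diff_sum: "divided_diff i (sum f A) = (\<Sum>x\<in>A. divided_diff i (f x))"
  by (induction A rule: infinite_finite_induct) (simp_all add: divided_diff_add)

lemma divided_diff_X_mult:
  "swap_vars i g = g \<Longrightarrow> divided_diff i (X i * g) = g"
  by (rule divided_diff_eqI) (simp add: swap_vars_mult algebra_simps)

lemma swap_vars_divided_diff [simp]: "swap_vars i (divided_diff i f) = divided_diff i f"
proof -
  have "(X (Suc i) - X i) * swap_vars i (divided_diff i f) = swap_vars i f - f"
    using arg_cong[OF divided_diff_spec[of i f], of "swap_vars i"]
    by (simp add: swap_vars_mult swap_vars_diff)
  then have "(X i - X (Suc i)) * swap_vars i (divided_diff i f) = f - swap_vars i f"
    by (simp add: algebra_simps)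
  from divided_diff_eqI[OF this] show ?thesis by simp
qed

lemma divided_diff_divided_diff [simp]: "divided_diff i (divided_diff i f) = 0"
  by (simp add: divided_diff_eq_0_iff)

text \<open>Each denominator is invariant under the other exchange. After multiplication by both,
  either side becomes the same alternating sum over the group generated by the two commuting
  transpositions.\<close>

lemma divided_diff_comm:
  assumes "Suc i < j"
  shows "divided_diff i (divided_diff j f) = divided_diff j (divided_diff i f)"
proof -
  let ?a = "X i - X (Suc i)" and ?b = "X j - X (Suc j)"
  have adj: "adj i j = j" "adj i (Suc j) = Suc j" "adj j i = i" "adj j (Suc i) = Suc i"
    using assms by (auto simp: Transposition.transpose_def)
  have key: "?a * (?b * divided_diff i (divided_diff j f)) = f - swap_vars j f - swap_vars i f + swap_vars i (swap_vars j f)"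
  proof -
    have "?b * divided_diff i (divided_diff j f) = divided_diff i (f - swap_vars j f)"
      by (subst divided_diff_mult_of_sym[symmetric])
         (simp_all add: swap_vars_diff adj divided_diff_spec)
    then show ?thesis by (simp add: divided_diff_spec swap_vars_diff)
  qed
  have other: "?b * (?a * divided_diff j (divided_diff i f)) = f - swap_vars i f - swap_vars j f + swap_vars j (swap_vars i f)"
  proof -
    have "?a * divided_diff j (divided_diff i f) = divided_diff j (f - swap_vars i f)"
      by (subst divided_diff_mult_of_sym[symmetric])
         (simp_all add: swap_vars_diff adj divided_diff_spec)
    then show ?thesis by (simp add: divided_diff_spec swap_vars_diff)
  qed
  have "?a * (?b * divided_diff i (divided_diff j f)) = ?b * (?a * divided_diff j (divided_diff i f))"
    unfolding key other by (simp add: swap_vars_comm[OF assms])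
  also have "\<dots> = ?a * (?b * divided_diff j (divided_diff i f))"
    by (rule mult.left_commute)
  finally have "?a * (?b * divided_diff i (divided_diff j f)) = ?a * (?b * divided_diff j (divided_diff i f))" .
  then show ?thesis using X_diff_neq_0[of i] X_diff_neq_0[of j] by simp
qed

text \<open>Multiplied by all three differences of a, b, c, both sides become the alternating sum
  over the permutations of the three variables. The two sums differ only in how the longest
  permutation is written, which \<open>swap_vars_braid\<close> settles.\<close>

lemma divided_diff_braid:
  "divided_diff i (divided_diff (Suc i) (divided_diff i f))
    = divided_diff (Suc i) (divided_diff i (divided_diff (Suc i) f))"
proof -
  define a b c where "a = X i" and "b = X (Suc i)" and "c = X (Suc (Suc i))"
  have adj: "adj (Suc i) i = i" "adj i (Suc (Suc i)) = Suc (Suc i)"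
    by (auto simp: Transposition.transpose_def)
  let ?s = "swap_vars i" and ?t = "swap_vars (Suc i)"
  let ?D = "divided_diff i" and ?E = "divided_diff (Suc i)"
  note hom = swap_vars_mult swap_vars_diff a_def b_def c_def adj
  have D: "(a - b) * ?D f = f - ?s f" for f
    by (simp add: a_def b_def divided_diff_spec)
  have E: "(b - c) * ?E f = f - ?t f" for f
    by (simp add: b_def c_def divided_diff_spec)
  have tD: "(a - c) * ?t (?D f) = ?t f - ?t (?s f)" for f
    using arg_cong[OF D[of f], of ?t] by (simp add: hom)
  have sE: "(a - c) * ?s (?E f) = ?s f - ?s (?t f)" for f
    using arg_cong[OF E[of f], of ?s] by (simp add: hom)
  have ED: "(a - b) * ((a - c) * ((b - c) * ?E (?D f))) = (a - c) * (f - ?s f) - (a - b) * (?t f - ?t (?s f))"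
  proof -
    have "(a - b) * ((a - c) * ((b - c) * ?E (?D f))) = (a - c) * ((a - b) * ?D f) - (a - b) * ((a - c) * ?t (?D f))"
      unfolding E by (simp add: algebra_simps)
    then show ?thesis unfolding D tD .
  qed
  have DE: "(b - c) * ((a - c) * ((a - b) * ?D (?E f))) = (a - c) * (f - ?t f) - (b - c) * (?s f - ?s (?t f))"
  proof -
    have "(b - c) * ((a - c) * ((a - b) * ?D (?E f))) = (a - c) * ((b - c) * ?E f) - (b - c) * ((a - c) * ?s (?E f))"
      unfolding D by (simp add: algebra_simps)
    then show ?thesis unfolding E sE .
  qed
  let ?W = "(f - ?s f - ?t f + ?t (?s f) + ?s (?t f) - ?s (?t (?s f)))"
  have 1: "(a - c) * ((b - c) * ((a - b) * ?D (?E (?D f)))) = ?W"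
  proof -
    have s: "(b - a) * ((b - c) * ((a - c) * ?s (?E (?D f)))) = (b - c) * (?s f - f) - (b - a) * (?s (?t f) - ?s (?t (?s f)))"
      using arg_cong[OF ED, of ?s] by (simp add: hom)
    \<comment> \<open>The surplus factor \<open>a - b\<close> makes \<open>ED\<close> and its image
      under \<open>?s\<close> applicable; it is cancelled at the end.\<close>
    have "(a - b) * ((a - c) * ((b - c) * ((a - b) * ?D (?E (?D f)))))
       = (a - b) * ((a - c) * ((b - c) * ?E (?D f))) + (b - a) * ((b - c) * ((a - c) * ?s (?E (?D f))))"
      unfolding D by (simp add: algebra_simps)
    also have "\<dots> = (a - b) * ?W"
      unfolding ED s by (simp add: algebra_simps)
    finally show ?thesis using X_diff_neq_0[of i] by (simp add: a_def b_def)
  qed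
  have 2: "(a - c) * ((a - b) * ((b - c) * ?E (?D (?E f)))) = (f - ?t f - ?s f + ?s (?t f) + ?t (?s f) - ?t (?s (?t f)))"
  proof -
    have s: "(c - b) * ((a - b) * ((a - c) * ?t (?D (?E f)))) = (a - b) * (?t f - f) - (c - b) * (?t (?s f) - ?t (?s (?t f)))"
      using arg_cong[OF DE, of ?t] by (simp add: hom)
    have "(b - c) * ((a - c) * ((a - b) * ((b - c) * ?E (?D (?E f)))))
       = (b - c) * ((a - c) * ((a - b) * ?D (?E f))) + (c - b) * ((a - b) * ((a - c) * ?t (?D (?E f))))"
      unfolding E by (simp add: algebra_simps)
    also have "\<dots> = (b - c) * (f - ?t f - ?s f + ?s (?t f) + ?t (?s f) - ?t (?s (?t f)))"
      unfolding DE s by (simp add: algebra_simps)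
    finally show ?thesis using X_diff_neq_0[of "Suc i"] by (simp add: b_def c_def)
  qed
  have "(a - c) * ((a - b) * ((b - c) * ?D (?E (?D f)))) = (a - c) * ((b - c) * ((a - b) * ?D (?E (?D f))))"
    by (simp only: mult.left_commute)
  also have "\<dots> = (a - c) * ((a - b) * ((b - c) * ?E (?D (?E f))))"
    unfolding 1 2 by (simp add: swap_vars_braid)
  finally have "(a - c) * ((a - b) * ((b - c) * ?D (?E (?D f)))) = (a - c) * ((a - b) * ((b - c) * ?E (?D (?E f))))" .
  moreover have "a - c \<noteq> 0"
  proof
    assume "a - c = 0"
    then have "degv i (X i) = degv i (X (Suc (Suc i)))" by (simp add: a_def c_def)
    then show False by (simp add: degv_X)
  qed
  ultimately show ?thesis
    using X_diff_neq_0[of i] X_diff_neq_0[of "Suc i"] by (simp add: a_def b_def c_def)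
qed

section \<open>Degrees of divided differences\<close>

lemma degv_X_diff: "degv j (X i - X (Suc i)) = (if j = i \<or> j = Suc i then 1 else 0)"
proof -
  consider "j = i" | "j = Suc i" | "j \<noteq> i" "j \<noteq> Suc i" by blast
  then show ?thesis
  proof cases
    case 1
    then show ?thesis using degv_add_eq_left[of i "- X (Suc i)" "X i"] by (simp add: degv_X)
  next
    case 2
    then show ?thesis using degv_add_eq_left[of "Suc i" "X i" "- X (Suc i)"] by (simp add: degv_X)
  next
    case 3
    then show ?thesis using degv_diff_le[of j "X i" "X (Suc i)"] by (simp add: degv_X)
  qed
qed

text \<open>Division by x_i - x_(i+1) lowers the degree in x_i by one, and the quotient is symmetric
  in the two variables, so one bound implies the other.\<close>

lemma degv_divided_diff_le_same:
  assumes "degv i f \<le> Suc d" "degv (Suc i) f \<le> Suc d"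
  shows "degv i (divided_diff i f) \<le> d" "degv (Suc i) (divided_diff i f) \<le> d"
proof -
  have "degv i (divided_diff i f) \<le> d"
  proof (cases "divided_diff i f = 0")
    case False
    have "1 + degv i (divided_diff i f) = degv i (f - swap_vars i f)"
      using degv_mult[OF X_diff_neq_0[of i] False, of i] by (simp add: degv_X_diff divided_diff_spec)
    also have "\<dots> \<le> Suc d"
      using degv_diff_le[of i f "swap_vars i f"] assms by (simp add: degv_swap_vars)
    finally show ?thesis by simp
  qed simp
  then show "degv i (divided_diff i f) \<le> d" "degv (Suc i) (divided_diff i f) \<le> d"
    using degv_swap_vars[of i i "divided_diff i f"] by simp_all
qed

lemma degv_divided_diff_le_other:
  assumes "j \<noteq> i" "j \<noteq> Suc i"
  shows "degv j (divided_diff i f) \<le> degv j f"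
proof (cases "divided_diff i f = 0")
  case False
  have "degv j (divided_diff i f) = degv j (f - swap_vars i f)"
    using degv_mult[OF X_diff_neq_0[of i] False, of j] assms by (simp add: degv_X_diff divided_diff_spec)
  then show ?thesis
    using degv_diff_le[of j f "swap_vars i f"] assms by (simp add: degv_swap_vars Transposition.transpose_def)
qed simp

subsection \<open>Schubert polynomials\<close>

lemma adj_permutes: "1 \<le> i \<Longrightarrow> i < n \<Longrightarrow> adj i permutes {1..n}"
  by (rule permutes_swap_id) auto

lemma Sn_comp_adj: "w \<in> Sn n \<Longrightarrow> 1 \<le> i \<Longrightarrow> i < n \<Longrightarrow> w \<circ> adj i \<in> Sn n"
  unfolding Sn_def using permutes_compose[OF adj_permutes] by blast

lemma comp_adj_comp_adj [simp]: "w \<circ> adj i \<circ> adj i = w"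
  by (simp add: comp_assoc)

lemma Sn_fixed: "w \<in> Sn n \<Longrightarrow> j \<notin> {1..n} \<Longrightarrow> w j = j"
  unfolding Sn_def by (simp add: permutes_not_in)

lemma Sn_in: "w \<in> Sn n \<Longrightarrow> 1 \<le> j \<Longrightarrow> j \<le> n \<Longrightarrow> 1 \<le> w j \<and> w j \<le> n"
  unfolding Sn_def using permutes_in_image[of w "{1..n}" j] by simp

lemma Sn_inj: "w \<in> Sn n \<Longrightarrow> w a = w b \<longleftrightarrow> a = b"
  unfolding Sn_def by (auto dest: permutes_inj injD)

lemma Sn_mono: "m \<le> n \<Longrightarrow> Sn m \<subseteq> Sn n"
  unfolding Sn_def by (auto intro: permutes_subset)

lemma Sn_zero_fixed: "w \<in> Sn n \<Longrightarrow> w 0 = 0"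
  by (rule Sn_fixed) auto

lemma finite_Sn [simp]: "finite (Sn n)"
  unfolding Sn_def by (simp add: finite_permutations)

lemma id_in_Sn [simp]: "id \<in> Sn n"
  unfolding Sn_def by (simp add: permutes_id)

lemma Sn_descent_less:
  assumes "w \<in> Sn n" "1 \<le> i" "w (Suc i) < w i"
  shows "i < n"
proof (rule ccontr)
  assume "\<not> i < n"
  then have "w (Suc i) = Suc i" "w i \<le> i"
    using assms Sn_fixed[of w n i] Sn_in[of w n i] Sn_fixed[of w n "Suc i"]
    by (cases "i = n"; simp)+
  then show False using assms by simp
qed

text \<open>Instead of the number of inversions, \<open>\<Sum> j w(j)\<close> serves as the measure for
  inductions along descents, since it grows by \<open>w(i) - w(i+1)\<close> when a descent at \<open>i\<close> is removed.\<close>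

definition moment :: "nat \<Rightarrow> (nat \<Rightarrow> nat) \<Rightarrow> nat" where
  "moment n w = (\<Sum>j=1..n. j * w j)"

lemma moment_comp_adj:
  assumes "1 \<le> i" "i < n"
  shows "moment n (w \<circ> adj i) + w (Suc i) = moment n w + w i"
proof -
  have split: "{1..n} = insert i (insert (Suc i) ({1..n} - {i, Suc i}))"
    using assms by auto
  have "(\<Sum>j\<in>{1..n} - {i, Suc i}. j * (w \<circ> adj i) j) = (\<Sum>j\<in>{1..n} - {i, Suc i}. j * w j)"
    by (rule sum.cong) (auto simp: Transposition.transpose_def)
  then show ?thesis
    unfolding moment_def by (subst (1 2) split) (simp add: algebra_simps)
qed

text \<open>A crude bound suffices: it turns growth of the moment into decrease of
  \<open>n * (n * n) - moment n w\<close>.\<close>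

lemma moment_le: 
  assumes "w \<in> Sn n"
  shows "moment n w \<le> n * (n * n)"
proof -
  have "moment n w \<le> (\<Sum>j=1..n. n * n)"
    unfolding moment_def by (rule sum_mono) (use Sn_in[OF assms] in \<open>auto intro: mult_mono\<close>)
  then show ?thesis by simp
qed

text \<open>Values drop by at least one at each step. Comparison with the largest possible value at
  1 and the smallest possible value at n squeezes \<open>w j\<close> from both sides.\<close>

lemma Sn_no_ascent:
  assumes w: "w \<in> Sn n" and "\<And>i. 1 \<le> i \<Longrightarrow> i < n \<Longrightarrow> w (Suc i) < w i"
  shows "w = longest_perm n"
proof
  have step: "w k + (k - j) \<le> w j" if "1 \<le> j" "j \<le> k" "k \<le> n" for j k
    using that(2,3)
  proof (induction k rule: dec_induct)
    case (step k)
    then show ?case using assms(2)[of k] that(1) by fastforce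
  qed simp
  fix j show "w j = longest_perm n j"
    using step[of 1 j] step[of j n] Sn_in[OF w, of 1] Sn_in[OF w, of n] Sn_fixed[OF w, of j]
    by (cases "1 \<le> j \<and> j \<le> n") (auto simp: longest_perm_def)
qed

lemma Sn_no_descent:
  assumes w: "w \<in> Sn n" and "\<And>i. 1 \<le> i \<Longrightarrow> i < n \<Longrightarrow> w i < w (Suc i)"
  shows "w = id"
proof
  have step: "w j + (k - j) \<le> w k" if "1 \<le> j" "j \<le> k" "k \<le> n" for j k
    using that(2,3)
  proof (induction k rule: dec_induct)
    case (step k)
    then show ?case using assms(2)[of k] that(1) by fastforce
  qed simp
  fix j show "w j = id j"
    using step[of 1 j] step[of j n] Sn_in[OF w, of 1] Sn_in[OF w, of n] Sn_fixed[OF w, of j]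
    by (cases "1 \<le> j \<and> j \<le> n") auto
qed

section \<open>Existence and uniqueness of Schubert polynomials\<close>

lemma longest_perm_in_Sn: "longest_perm n \<in> Sn n"
  unfolding Sn_def mem_Collect_eq
proof (rule bij_imp_permutes)
  show "bij_betw (longest_perm n) {1..n} {1..n}"
    by (rule bij_betwI[of _ _ _ "longest_perm n"]) (auto simp: longest_perm_def)
qed (auto simp: longest_perm_def)

text \<open>Fixing the starting point \<open>n\<close> keeps all derivations inside \<^term>\<open>Sn n\<close>, where two last steps
  at different descents can be joined by the commutation or the braid relation.\<close>

inductive schubert_from :: "nat \<Rightarrow> (nat \<Rightarrow> nat) \<Rightarrow> mpoly \<Rightarrow> bool" for n where
  longest: "schubert_from n (longest_perm n) (\<Prod>i=1..n. X i ^ (n - i))"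
| descent: "schubert_from n (w \<circ> adj i) (divided_diff i p)"
    if "schubert_from n w p" "1 \<le> i" "w i > w (Suc i)"

lemma schubert_from_Sn: "schubert_from n w p \<Longrightarrow> w \<in> Sn n"
  by (induction rule: schubert_from.induct) (blast intro: longest_perm_in_Sn Sn_comp_adj Sn_descent_less)+

lemma moment_ascent:
  "1 \<le> i \<Longrightarrow> i < n \<Longrightarrow> w i < w (Suc i) \<Longrightarrow> moment n (w \<circ> adj i) < moment n w"
  using moment_comp_adj[of i n w] by linarith

text \<open>Turning an ascent into a descent lowers the moment, so this ends at the longest
  permutation; the derivation runs through the same permutations backwards.\<close>

lemma schubert_from_exists: "w \<in> Sn n \<Longrightarrow> \<exists>p. schubert_from n w p"
proof (induction "moment n w" arbitrary: w rule: less_induct)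
  case less
  show ?case
  proof (cases "w = longest_perm n")
    case True
    then show ?thesis using schubert_from.longest by blast
  next
    case False
    then obtain i where i: "1 \<le> i" "i < n" "\<not> w (Suc i) < w i"
      using Sn_no_ascent[OF less.prems] by blast
    then have asc: "w i < w (Suc i)"
      using Sn_inj[OF less.prems, of i "Suc i"] by linarith
    obtain p where "schubert_from n (w \<circ> adj i) p"
      using less.hyps[OF moment_ascent[OF i(1,2) asc] Sn_comp_adj[OF less.prems i(1,2)]] by blast
    from schubert_from.descent[OF this i(1)] asc show ?thesis by auto
  qed
qed

text \<open>Both \<open>w1\<close> and \<open>w2\<close> have smaller moment than \<open>w\<close>.
  By \<open>IH\<close>, \<open>p\<close> and \<open>q\<close> may therefore be recomputed from a
  common ancestor \<open>v\<close> that has the descents needed on both routes.\<close>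

lemma schubert_from_diamond:
  assumes IH: "\<And>v p q. moment n v < moment n w \<Longrightarrow> schubert_from n v p \<Longrightarrow> schubert_from n v q \<Longrightarrow> p = q"
    and p: "schubert_from n w1 p" "1 \<le> i" "w1 i > w1 (Suc i)" "w = w1 \<circ> adj i"
    and q: "schubert_from n w2 q" "1 \<le> j" "w2 j > w2 (Suc j)" "w = w2 \<circ> adj j"
    and "i < j"
  shows "divided_diff i p = divided_diff j q"
proof -
  have ij: "i < n" "j < n"
    using Sn_descent_less[OF schubert_from_Sn] p q by blast+
  have wn: "w \<in> Sn n"
    using p(4) Sn_comp_adj[OF schubert_from_Sn[OF p(1)] p(2) ij(1)] by simp
  have w1: "w1 = w \<circ> adj i" unfolding p(4) by simp
  have w2: "w2 = w \<circ> adj j" unfolding q(4) by simp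
  have asc1: "w i < w (Suc i)" using p(3) unfolding p(4) by simp
  have asc2: "w j < w (Suc j)" using q(3) unfolding q(4) by simp
  note asc = asc1 asc2
  have less: "moment n w1 < moment n w" "moment n w2 < moment n w"
    unfolding w1 w2 using moment_ascent p(2) q(2) ij asc by blast+
  show ?thesis
  proof (cases "j = Suc i")
    case False
    then have far: "Suc i < j" using \<open>i < j\<close> by simp
    define v where "v = w \<circ> adj i \<circ> adj j"
    have "v \<in> Sn n"
      unfolding v_def using wn ij p(2) q(2) by (intro Sn_comp_adj)
    then obtain r where r: "schubert_from n v r" using schubert_from_exists by blast
    have "adj j \<circ> adj i = adj i \<circ> adj j"
      using far by (auto simp: fun_eq_iff Transposition.transpose_def)
    then have v1: "v \<circ> adj j = w1" and v2: "v \<circ> adj i = w2"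
      unfolding v_def w1 w2 by (simp_all add: comp_assoc) (metis comp_assoc transpose_comp_involutory comp_id)
    have "v j > v (Suc j)" "v i > v (Suc i)"
      unfolding v_def using far asc by (auto simp: Transposition.transpose_def)
    then have "schubert_from n w1 (divided_diff j r)" "schubert_from n w2 (divided_diff i r)"
      using schubert_from.descent[OF r] p(2) q(2) v1 v2 by metis+
    then have "p = divided_diff j r" "q = divided_diff i r"
      using IH less p(1) q(1) by blast+
    then show ?thesis using divided_diff_comm[OF far] by simp
  next
    case True
    \<comment> \<open>The two ascents of \<open>w\<close> are adjacent, so \<open>w\<close>
      increases on i, i+1, i+2; here these three entries are reversed.\<close>
    define v where "v = w \<circ> adj i \<circ> adj j \<circ> adj i"
    have "v \<in> Sn n"
      unfolding v_def using wn ij p(2) q(2) by (intro Sn_comp_adj)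
    then obtain r where r: "schubert_from n v r" using schubert_from_exists by blast
    have "adj i \<circ> adj j \<circ> adj i = adj j \<circ> adj i \<circ> adj j"
      unfolding True by (auto simp: fun_eq_iff Transposition.transpose_def)
    then have v': "v = w \<circ> adj j \<circ> adj i \<circ> adj j"
      unfolding v_def by (metis comp_assoc)
    have v1: "v \<circ> adj i \<circ> adj j = w1" and v2: "v \<circ> adj j \<circ> adj i = w2"
      unfolding w1 w2 by (simp add: v_def, simp add: v')
    have "v i > v (Suc i)" "(v \<circ> adj i) j > (v \<circ> adj i) (Suc j)"
       "v j > v (Suc j)" "(v \<circ> adj j) i > (v \<circ> adj j) (Suc i)"
      unfolding v_def using asc True by (auto simp: Transposition.transpose_def)
    then have "schubert_from n w1 (divided_diff j (divided_diff i r))" "schubert_from n w2 (divided_diff i (divided_diff j r))"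
      using schubert_from.descent[OF schubert_from.descent[OF r]] p(2) q(2) v1 v2 by metis+
    then have "p = divided_diff j (divided_diff i r)" "q = divided_diff i (divided_diff j r)"
      using IH less p(1) q(1) by blast+
    then show ?thesis using divided_diff_braid[of i r] True by simp
  qed
qed

lemma schubert_from_unique: "schubert_from n w p \<Longrightarrow> schubert_from n w q \<Longrightarrow> p = q"
proof (induction "moment n w" arbitrary: w p q rule: less_induct)
  case less
  have IH: "a = b" if "moment n v < moment n w" "schubert_from n v a" "schubert_from n v b" for v a b
    using less.hyps that by blast
  \<comment> \<open>A descent step creates an ascent at some i < n, which the longest permutation
    does not have; hence it arises only by the base rule.\<close>
  have no_asc: "\<not> longest_perm n = v \<circ> adj i" if "schubert_from n v r" "1 \<le> i" "v (Suc i) < v i" for v r i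
  proof
    assume *: "longest_perm n = v \<circ> adj i"
    have "i < n" using Sn_descent_less[OF schubert_from_Sn] that by blast
    then show False
      using fun_cong[OF *, of i] fun_cong[OF *, of "Suc i"] that by (auto simp: longest_perm_def)
  qed
  show ?case
    using less.prems(1)
  proof cases
    case longest
    from less.prems(2) show ?thesis
      by cases (use longest no_asc in metis)+
  next
    case p: (descent w1 p1 i)
    from less.prems(2) show ?thesis
    proof cases
      case longest
      then show ?thesis using p no_asc by metis
    next
      case q: (descent w2 q2 j)
      consider "i < j" | "j < i" | "i = j" by linarith
      then show ?thesis
      proof cases
        case 1
        then show ?thesis
          using schubert_from_diamond[of n w w1 p1 i w2 q2 j] IH p q by blast
      next
        case 2
        then show ?thesis
          using schubert_from_diamond[of n w w2 q2 j w1 p1 i] IH p q by metis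
      next
        case 3
        have "w1 = w2" using p q 3 by (metis comp_adj_comp_adj)
        moreover have "moment n w1 < moment n w"
          using moment_comp_adj[of i n w1] p Sn_descent_less[OF schubert_from_Sn[OF p(3)]] by simp
        ultimately show ?thesis using IH[of w1 p1 q2] p q 3 by simp
      qed
    qed
  qed
qed

text \<open>Stability of the starting point: descents at 1, 2, ..., n move the value n+1 from the
  front to the last position and lower each exponent of the staircase monomial by one.\<close>

lemma schubert_from_longest_Suc: "schubert_from (Suc n) (longest_perm n) (\<Prod>i=1..n. X i ^ (n - i))"
proof -
  \<comment> \<open>The stage after k moves: n+1 stands at position k+1, and the exponents of x_1,
    ..., x_k have already dropped.\<close>
  define W where "W k j = (if 1 \<le> j \<and> j \<le> k then n + 1 - j else if j = Suc k then Suc n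
      else if Suc k < j \<and> j \<le> Suc n then n + 2 - j else j)" for k j
  define P where "P k = (\<Prod>i=1..k. X i ^ (n - i)) * (\<Prod>i=Suc k..Suc n. X i ^ (Suc n - i))" for k
  have "schubert_from (Suc n) (W k) (P k)" if "k \<le> n" for k
    using that
  proof (induction k)
    case 0
    have "W 0 = longest_perm (Suc n)"
      by (auto simp: W_def longest_perm_def fun_eq_iff)
    moreover have "P 0 = (\<Prod>i=1..Suc n. X i ^ (Suc n - i))"
      by (simp add: P_def)
    ultimately show ?case using schubert_from.longest[of "Suc n"] by simp
  next
    case (Suc k)
    \<comment> \<open>In \<open>P k\<close> the exponents of x_(k+1) and x_(k+2) differ by one.
      Splitting off one x_(k+1) leaves \<open>?G\<close>, which is symmetric in these
      variables.\<close>
    let ?G = "(\<Prod>i=1..k. X i ^ (n - i)) * (X (Suc k) * X (Suc (Suc k))) ^ (n - Suc k)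
        * (\<Prod>i=Suc (Suc (Suc k))..Suc n. X i ^ (Suc n - i))"
    have "{Suc k..Suc n} = insert (Suc k) (insert (Suc (Suc k)) {Suc (Suc (Suc k))..Suc n})"
      using Suc.prems by auto
    then have "P k = (\<Prod>i=1..k. X i ^ (n - i)) * (X (Suc k) ^ Suc (n - Suc k) * (X (Suc (Suc k)) ^ (n - Suc k)
        * (\<Prod>i=Suc (Suc (Suc k))..Suc n. X i ^ (Suc n - i))))"
      unfolding P_def using Suc.prems by (simp add: Suc_diff_Suc del: power_Suc)
    then have Pk: "P k = X (Suc k) * ?G"
      by (simp add: power_mult_distrib algebra_simps)
    have "{Suc (Suc k)..Suc n} = insert (Suc (Suc k)) {Suc (Suc (Suc k))..Suc n}"
      using Suc.prems by auto
    then have PSk: "P (Suc k) = ?G"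
      unfolding P_def by (simp add: power_mult_distrib algebra_simps)
    have "swap_vars (Suc k) ?G = ?G"
    proof -
      have "swap_vars (Suc k) (X i ^ e) = X i ^ e" if "i \<noteq> Suc k" "i \<noteq> Suc (Suc k)" for i e
        using that by (simp add: swap_vars_power)
      note 1 = this
      have 2: "swap_vars (Suc k) (\<Prod>i\<in>A. X i ^ e i) = (\<Prod>i\<in>A. X i ^ e i)"
        if "Suc k \<notin> A" "Suc (Suc k) \<notin> A" for A e
        unfolding swap_vars_prod
      proof (rule prod.cong)
        fix x assume "x \<in> A"
        then show "swap_vars (Suc k) (X x ^ e x) = X x ^ e x"
          using that by (intro 1) auto
      qed simp
      have "swap_vars (Suc k) ((X (Suc k) * X (Suc (Suc k))) ^ (n - Suc k))
         = (X (Suc k) * X (Suc (Suc k))) ^ (n - Suc k)"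
        by (simp add: swap_vars_power swap_vars_mult mult.commute)
      then show ?thesis by (simp add: swap_vars_mult 2)
    qed
    then have "divided_diff (Suc k) (P k) = P (Suc k)"
      unfolding Pk PSk by (rule divided_diff_X_mult)
    moreover have "W k \<circ> adj (Suc k) = W (Suc k)"
      using Suc.prems by (auto simp: fun_eq_iff W_def Transposition.transpose_def)
    moreover have "W k (Suc k) > W k (Suc (Suc k))"
      using Suc.prems by (auto simp: W_def)
    ultimately show ?case
      using schubert_from.descent[OF Suc.IH, of "Suc k"] Suc.prems by simp
  qed
  from this[of n] have "schubert_from (Suc n) (W n) (P n)" by simp
  moreover have "W n = longest_perm n"
    by (auto simp: W_def longest_perm_def fun_eq_iff)
  moreover have "P n = (\<Prod>i=1..n. X i ^ (n - i))"
    by (simp add: P_def)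
  ultimately show ?thesis by simp
qed

lemma schubert_from_mono:
  assumes "schubert_from m w p" "m \<le> n"
  shows "schubert_from n w p"
  using assms(2)
proof (induction n rule: dec_induct)
  case (step n)
  then have "schubert_from n w p" by simp
  then show ?case
    by (induction rule: schubert_from.induct) (blast intro: schubert_from_longest_Suc schubert_from.descent)+
qed (use assms(1) in simp)

lemma is_schubert_imp_schubert_from: "is_schubert w p \<Longrightarrow> \<exists>n. schubert_from n w p"
  by (induction rule: is_schubert.induct) (blast intro: schubert_from.intros)+

lemma schubert_from_imp_is_schubert: "schubert_from n w p \<Longrightarrow> is_schubert w p"
  by (induction rule: schubert_from.induct) (blast intro: is_schubert.intros)+

lemma schubert_eqI:
  assumes "is_schubert w p"
  shows "schubert w = p"
  unfolding schubert_def
proof (rule the_equality)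
  fix q assume "is_schubert w q"
  then obtain m where m: "schubert_from m w q" using is_schubert_imp_schubert_from by blast
  obtain n where n: "schubert_from n w p" using is_schubert_imp_schubert_from assms by blast
  have "schubert_from (max m n) w q" "schubert_from (max m n) w p"
    using m n by (auto intro: schubert_from_mono)
  then show "q = p" by (rule schubert_from_unique)
qed (fact assms)

lemma schubert_from_schubert: "w \<in> Sn n \<Longrightarrow> schubert_from n w (schubert w)"
  using schubert_from_exists schubert_from_imp_is_schubert schubert_eqI by metis

lemma schubert_id: "schubert id = 1"
proof -
  have "longest_perm 0 = id" by (auto simp: longest_perm_def fun_eq_iff)
  then show ?thesis
    using schubert_eqI[OF is_schubert.longest[of 0]] by simp
qed

lemma divided_diff_schubert_descent:
  assumes "w \<in> Sn n" "1 \<le> i" "w (Suc i) < w i"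
  shows "divided_diff i (schubert w) = schubert (w \<circ> adj i)"
  using schubert_eqI[OF schubert_from_imp_is_schubert[OF schubert_from.descent[OF schubert_from_schubert[OF assms(1)] assms(2)]]] assms(3)
  by simp

text \<open>The polynomial of \<open>w\<close> is itself a divided difference at i, coming from
  \<open>w \<circ> adj i\<close>, and divided differences square to zero. Since i may exceed n, the
  argument takes place in a larger group.\<close>

lemma divided_diff_schubert_ascent:
  assumes "w \<in> Sn n" "1 \<le> i" "w i < w (Suc i)"
  shows "divided_diff i (schubert w) = 0"
proof -
  define N where "N = max n (Suc i)"
  have "w \<circ> adj i \<in> Sn N"
    using assms Sn_mono[of n N] by (auto intro!: Sn_comp_adj simp: N_def)
  from divided_diff_schubert_descent[OF this assms(2)] assms
  have "schubert w = divided_diff i (schubert (w \<circ> adj i))" by simp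
  then show ?thesis by simp
qed

section \<open>Non-vanishing and the staircase bound\<close>

lemma Sn_descent_exists:
  assumes "w \<in> Sn n" "w \<noteq> id"
  obtains i where "1 \<le> i" "i < n" "w (Suc i) < w i"
  using Sn_no_descent[OF assms(1)] assms Sn_inj[OF assms(1)] by (metis n_not_Suc_n nat_neq_iff)

lemma Sn_descent_induct [consumes 1, case_names step]:
  assumes "w \<in> Sn n"
    and "\<And>w. w \<in> Sn n \<Longrightarrow> (\<And>i. 1 \<le> i \<Longrightarrow> i < n \<Longrightarrow> w (Suc i) < w i \<Longrightarrow> P (w \<circ> adj i)) \<Longrightarrow> P w"
  shows "P w"
  using assms(1)
proof (induction "n * (n * n) - moment n w" arbitrary: w rule: less_induct)
  case less
  show ?case
  proof (rule assms(2)[OF less.prems])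
    fix i assume i: "1 \<le> i" "i < n" "w (Suc i) < w i"
    then have "moment n w < moment n (w \<circ> adj i)"
      using moment_comp_adj[of i n w] by linarith
    then have "n * (n * n) - moment n (w \<circ> adj i) < n * (n * n) - moment n w"
      using moment_le[OF Sn_comp_adj[OF less.prems i(1,2)]] by linarith
    then show "P (w \<circ> adj i)"
      using less.hyps Sn_comp_adj[OF less.prems i(1,2)] by blast
  qed
qed

text \<open>Divided differences at descents lead down to the identity, whose polynomial is 1, while
  they send 0 to 0.\<close>

lemma schubert_neq_0: "w \<in> Sn n \<Longrightarrow> schubert w \<noteq> 0"
proof (induction rule: Sn_descent_induct)
  case (step w)
  show ?case
  proof (cases "w = id")
    case False
    then obtain i where i: "1 \<le> i" "i < n" "w (Suc i) < w i"
      using Sn_descent_exists step.hyps by blast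
    then have "divided_diff i (schubert w) \<noteq> 0"
      using step.IH[OF i] divided_diff_schubert_descent[OF step.hyps i(1,3)] by metis
    then show ?thesis by auto
  qed (metis schubert_id zero_neq_one)
qed

text \<open>Equivalently, every monomial of f divides the staircase monomial of \<open>Sn n\<close>;
  in particular x_0 does not occur.\<close>

definition staircase_bounded :: "nat \<Rightarrow> mpoly \<Rightarrow> bool" where
  "staircase_bounded n f \<longleftrightarrow> (\<forall>j. degv j f \<le> (if j = 0 then 0 else n - j))"

lemma degv_power_le: "degv j (f ^ k) \<le> k * degv j f"
proof (induction k)
  case (Suc k)
  then show ?case using degv_mult_le[of j f "f ^ k"] by simp
qed simp

lemma degv_prod_le: "degv j (prod f A) \<le> (\<Sum>x\<in>A. degv j (f x))"
proof (induction A rule: infinite_finite_induct)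
  case (insert x F)
  then show ?case using degv_mult_le[of j "f x" "prod f F"] by simp
qed simp_all

text \<open>Symmetrising in x_i and x_(i+1) could violate the tighter bound n - i - 1 at i+1, but
  the drop by one in the degree makes up for it.\<close>

lemma staircase_bounded_divided_diff:
  assumes "staircase_bounded n f" "1 \<le> i" "i < n"
  shows "staircase_bounded n (divided_diff i f)"
  unfolding staircase_bounded_def
proof
  fix j
  have "degv i f \<le> Suc (n - Suc i)" "degv (Suc i) f \<le> Suc (n - Suc i)"
    using assms spec[OF assms(1)[unfolded staircase_bounded_def], of i]
      spec[OF assms(1)[unfolded staircase_bounded_def], of "Suc i"] by auto
  from degv_divided_diff_le_same[OF this]
  show "degv j (divided_diff i f) \<le> (if j = 0 then 0 else n - j)"
    using degv_divided_diff_le_other[of j i f] assms spec[OF assms(1)[unfolded staircase_bounded_def], of j]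
    by (cases "j = i \<or> j = Suc i") (auto split: if_splits)
qed

lemma staircase_bounded_schubert_from: "schubert_from n w p \<Longrightarrow> staircase_bounded n p"
proof (induction rule: schubert_from.induct)
  case longest
  show ?case
    unfolding staircase_bounded_def
  proof
    fix j
    have "degv j (\<Prod>i=1..n. X i ^ (n - i)) \<le> (\<Sum>i=1..n. degv j (X i ^ (n - i)))"
      by (rule degv_prod_le)
    also have "\<dots> \<le> (\<Sum>i=1..n. if j = i then n - i else 0)"
      by (rule sum_mono, rule order_trans[OF degv_power_le]) (simp add: degv_X)
    also have "\<dots> \<le> (if j = 0 then 0 else n - j)"
      by (simp add: sum.delta')
    finally show "degv j (\<Prod>i=1..n. X i ^ (n - i)) \<le> (if j = 0 then 0 else n - j)" .
  qed
next
  case (descent w p i)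
  then show ?case
    using staircase_bounded_divided_diff Sn_descent_less[OF schubert_from_Sn] by blast
qed

lemma staircase_bounded_schubert: "w \<in> Sn n \<Longrightarrow> staircase_bounded n (schubert w)"
  using schubert_from_schubert staircase_bounded_schubert_from by blast

lemma degv_schubert_eq_0: "w \<in> Sn n \<Longrightarrow> n \<le> j \<Longrightarrow> degv j (schubert w) = 0"
  using staircase_bounded_schubert[of w n] unfolding staircase_bounded_def by (metis diff_is_0_eq le_zero_eq)

text \<open>\<open>nonrec w j\<close> is \<open>\<chi>\<^sub>j(w) = 1\<close>, and \<open>Lam n w i\<close> is \<open>\<Lambda>\<^sub>i(w)\<close> for \<open>w\<close> in \<^term>\<open>Sn n\<close>. Position \<open>0\<close> is harmless since \<open>w(0) = 0\<close>.\<close>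

definition nonrec :: "(nat \<Rightarrow> nat) \<Rightarrow> nat \<Rightarrow> bool" where
  "nonrec w j \<longleftrightarrow> (\<exists>k<j. w j < w k)"

definition Lam :: "nat \<Rightarrow> (nat \<Rightarrow> nat) \<Rightarrow> nat \<Rightarrow> nat" where
  "Lam n w i = card {j\<in>{i..n}. nonrec w j}"

section \<open>Degrees of Schubert polynomials in terms of records\<close>

lemma nonrec_comp_adj:
  assumes "Suc i < j"
  shows "nonrec (w \<circ> adj i) j \<longleftrightarrow> nonrec w j"
proof -
  have "(\<exists>k<j. w j < w (adj i k)) \<longleftrightarrow> (\<exists>k<j. w j < w k)"
  proof
    assume "\<exists>k<j. w j < w k"
    then obtain k where "k < j" "w j < w (adj i (adj i k))" by auto
    moreover have "adj i k < j" using \<open>k < j\<close> assms by (auto simp: Transposition.transpose_def)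
    ultimately show "\<exists>k<j. w j < w (adj i k)" by blast
  next
    assume "\<exists>k<j. w j < w (adj i k)"
    then obtain k where "k < j" "w j < w (adj i k)" by auto
    moreover have "adj i k < j" using \<open>k < j\<close> assms by (auto simp: Transposition.transpose_def)
    ultimately show "\<exists>k<j. w j < w k" by blast
  qed
  then show ?thesis using assms by (simp add: nonrec_def)
qed

lemma Lam_comp_adj: "Lam n (w \<circ> adj i) (Suc (Suc i)) = Lam n w (Suc (Suc i))"
  unfolding Lam_def by (rule arg_cong[where f = card]) (use nonrec_comp_adj[of i] in auto)

lemma Lam_Suc: "i \<le> n \<Longrightarrow> Lam n w i = Lam n w (Suc i) + (if nonrec w i then 1 else 0)"
proof -
  assume "i \<le> n"
  then have "{j\<in>{i..n}. nonrec w j} = {j\<in>{Suc i..n}. nonrec w j} \<union> (if nonrec w i then {i} else {})"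
    by (auto simp: le_less Suc_le_eq)
  then show ?thesis unfolding Lam_def by simp
qed

lemma divided_diff_split: "f = swap_vars i f + (X i - X (Suc i)) * divided_diff i f"
  by (simp add: divided_diff_spec)

lemma degv_mult_X_diff:
  "g \<noteq> 0 \<Longrightarrow> swap_vars i g = g \<Longrightarrow> degv i ((X i - X (Suc i)) * g) = Suc (degv (Suc i) g)"
  using degv_swap_vars[of i i g] degv_mult[OF X_diff_neq_0[of i], of g i] by (simp add: degv_X_diff)

text \<open>At an ascent the polynomial is symmetric in x_i and x_(i+1), so the bound at i+1 carries
  over. At a descent position i+1 is not a record, which pays for the factor x_i - x_(i+1); the
  induction must range over all permutations because the cofactor belongs to
  \<open>w \<circ> adj i\<close>.\<close>

lemma degv_schubert_le: "w \<in> Sn n \<Longrightarrow> degv i (schubert w) \<le> Lam n w (Suc i)"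
proof (induction "n - i" arbitrary: i w)
  case 0
  then show ?case using degv_schubert_eq_0 by simp
next
  case (Suc d)
  show ?case
  proof (cases "i = 0")
    case True
    then show ?thesis
      using staircase_bounded_schubert[OF Suc.prems, unfolded staircase_bounded_def, THEN spec[of _ 0]] by simp
  next
    case False
    have i: "1 \<le> i" "i < n" "d = n - Suc i" using Suc.hyps False by auto
    note IH = Suc.hyps(1)[OF i(3)]
    have sw: "degv i (swap_vars i f) = degv (Suc i) f" for f
      by (simp add: degv_swap_vars)
    consider "w i < w (Suc i)" | "w (Suc i) < w i"
      using Sn_inj[OF Suc.prems, of i "Suc i"] by (metis n_not_Suc_n nat_neq_iff)
    then show ?thesis
    proof cases
      case 1
      then have "swap_vars i (schubert w) = schubert w"
        using divided_diff_schubert_ascent[OF Suc.prems i(1)] by (simp add: divided_diff_eq_0_iff)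
      then have "degv i (schubert w) = degv (Suc i) (schubert w)" using sw by metis
      then show ?thesis using IH[OF Suc.prems] Lam_Suc[of "Suc i" n w] i by simp
    next
      case 2
      let ?g = "schubert (w \<circ> adj i)"
      have dd: "divided_diff i (schubert w) = ?g"
        using divided_diff_schubert_descent Suc.prems i 2 by blast
      have v: "w \<circ> adj i \<in> Sn n" using Sn_comp_adj Suc.prems i by blast
      have sg: "swap_vars i ?g = ?g" using dd swap_vars_divided_diff by metis
      have "degv i (schubert w) \<le> max (degv (Suc i) (schubert w)) (Suc (degv (Suc i) ?g))"
        using degv_add_le[of i "swap_vars i (schubert w)" "(X i - X (Suc i)) * ?g"]
          divided_diff_split[of "schubert w" i] degv_mult_X_diff[OF schubert_neq_0[OF v] sg] sw dd by simp
      moreover have "nonrec w (Suc i)" using 2 by (auto simp: nonrec_def)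
      ultimately show ?thesis
        using IH[OF Suc.prems] IH[OF v] Lam_Suc[of "Suc i" n w] Lam_comp_adj[of n w i] i by simp
    qed
  qed
qed

text \<open>If i+1 is not a record of \<open>w\<close>, the exchange moves the record value to i+1,
  so the cofactor attains its degree by induction. The other summand has strictly smaller degree in
  x_i by \<open>degv_schubert_le\<close>, hence nothing cancels.\<close>

lemma degv_schubert_record:
  "w \<in> Sn n \<Longrightarrow> 1 \<le> i \<Longrightarrow> \<not> nonrec w i \<Longrightarrow> degv i (schubert w) = Lam n w (Suc i)"
proof (induction "n - i" arbitrary: i w)
  case 0
  then show ?case using degv_schubert_eq_0[of w n i] by (simp add: Lam_def)
next
  case (Suc d)
  have i: "1 \<le> i" "i < n" "d = n - Suc i" using Suc.hyps Suc.prems by auto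
  note IH = Suc.hyps(1)[OF i(3)]
  have w: "w \<in> Sn n" by fact
  have sw: "degv i (swap_vars i f) = degv (Suc i) f" for f
    by (simp add: degv_swap_vars)
  have max: "w k \<le> w i" if "k \<le> i" for k
    using Suc.prems(3) that unfolding nonrec_def by (metis le_less not_less)
  show ?case
  proof (cases "nonrec w (Suc i)")
    case False
    then have "w i < w (Suc i)"
      using Sn_inj[OF w, of i "Suc i"] unfolding nonrec_def by (metis lessI n_not_Suc_n not_less_iff_gr_or_eq)
    then have "swap_vars i (schubert w) = schubert w"
      using divided_diff_schubert_ascent[OF w i(1)] by (simp add: divided_diff_eq_0_iff)
    then have "degv i (schubert w) = degv (Suc i) (schubert w)" using sw by metis
    then show ?thesis using IH[OF w _ False] Lam_Suc[of "Suc i" n w] i False by simp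
  next
    case True
    then have 2: "w (Suc i) < w i"
      using max unfolding nonrec_def by (metis less_Suc_eq_le less_le_trans)
    let ?v = "w \<circ> adj i"
    let ?g = "schubert ?v"
    have dd: "divided_diff i (schubert w) = ?g"
      using divided_diff_schubert_descent w i 2 by blast
    have v: "?v \<in> Sn n" using Sn_comp_adj w i by blast
    have sg: "swap_vars i ?g = ?g" using dd swap_vars_divided_diff by metis
    have "\<not> nonrec ?v (Suc i)"
      using 2 by (auto simp: nonrec_def not_less less_Suc_eq Transposition.transpose_def intro!: max)
    from IH[OF v _ this] have g: "degv (Suc i) ?g = Lam n w (Suc (Suc i))"
      using Lam_comp_adj by simp
    have "degv i (swap_vars i (schubert w)) < degv i ((X i - X (Suc i)) * ?g)"
      using degv_mult_X_diff[OF schubert_neq_0[OF v] sg] sw g degv_schubert_le[OF w, of "Suc i"] by simp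
    from degv_add_eq_left[OF this]
    have "degv i (schubert w) = Suc (degv (Suc i) ?g)"
      using divided_diff_split[of "schubert w" i] degv_mult_X_diff[OF schubert_neq_0[OF v] sg] dd
      by (simp add: add.commute)
    then show ?thesis using g Lam_Suc[of "Suc i" n w] i True by simp
  qed
qed

subsection \<open>The Schubert basis and forward stability\<close>

lemma bij_comp_adj: "1 \<le> i \<Longrightarrow> i < n \<Longrightarrow> bij_betw (\<lambda>w. w \<circ> adj i) (Sn n) (Sn n)"
  by (rule bij_betwI[of _ _ _ "\<lambda>w. w \<circ> adj i"]) (use Sn_comp_adj in force)+

text \<open>A divided difference at i annihilates the terms without descent at i and turns the
  others into a relation whose support has smaller \<open>\<psi>\<close>. By induction all
  coefficients at permutations with a descent vanish, and only the constant term of the identity is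
  left.\<close>

lemma schubert_independent:
  assumes "(\<Sum>w\<in>Sn n. of_int (c w) * schubert w) = 0" "w \<in> Sn n"
  shows "c w = 0"
proof -
  define \<psi> where "\<psi> w = n * (n * n) - moment n w" for w
  have "\<forall>w\<in>Sn n. c w = 0"
    if "\<forall>w\<in>Sn n. c w \<noteq> 0 \<longrightarrow> \<psi> w < L" "(\<Sum>w\<in>Sn n. of_int (c w) * schubert w) = 0"
    for L and c :: "(nat \<Rightarrow> nat) \<Rightarrow> int"
    using that
  proof (induction L arbitrary: c)
    case (Suc L)
    have desc: "c w = 0" if w: "w \<in> Sn n" and i: "1 \<le> i" "i < n" "w (Suc i) < w i" for w i
    proof -
      \<comment> \<open>The coefficients of the differentiated relation, indexed by the permutations
        after the exchange.\<close>
      define c' where "c' v = (if v i < v (Suc i) then c (v \<circ> adj i) else 0)" for v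
      have "(\<Sum>v\<in>Sn n. of_int (c' v) * schubert v)
          = (\<Sum>w\<in>Sn n. of_int (c' (w \<circ> adj i)) * schubert (w \<circ> adj i))"
        by (rule sum.reindex_bij_betw[OF bij_comp_adj[OF i(1,2)], symmetric])
      also have "\<dots> = (\<Sum>w\<in>Sn n. of_int (c w) * divided_diff i (schubert w))"
      proof (rule sum.cong)
        fix w assume w: "w \<in> Sn n"
        consider "w i < w (Suc i)" | "w (Suc i) < w i"
          using Sn_inj[OF w, of i "Suc i"] by (metis n_not_Suc_n nat_neq_iff)
        then show "of_int (c' (w \<circ> adj i)) * schubert (w \<circ> adj i) = of_int (c w) * divided_diff i (schubert w)"
        proof cases
          case 1
          then have "c' (w \<circ> adj i) = 0" by (simp add: c'_def)
          then show ?thesis using divided_diff_schubert_ascent[OF w i(1) 1] by simp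
        next
          case 2
          then have "c' (w \<circ> adj i) = c w" by (simp add: c'_def comp_assoc)
          then show ?thesis using divided_diff_schubert_descent[OF w i(1) 2] by simp
        qed
      qed simp
      also have "\<dots> = divided_diff i (\<Sum>w\<in>Sn n. of_int (c w) * schubert w)"
        by (simp add: divided_diff_sum divided_diff_of_int_mult)
      also have "\<dots> = 0" by (simp add: Suc.prems)
      finally have sum0: "(\<Sum>v\<in>Sn n. of_int (c' v) * schubert v) = 0" .
      have "\<psi> v < L" if v: "v \<in> Sn n" and nz: "c' v \<noteq> 0" for v
      proof -
        have asc: "v i < v (Suc i)" and "c (v \<circ> adj i) \<noteq> 0"
          using nz by (auto simp: c'_def split: if_splits)
        then have "\<psi> (v \<circ> adj i) < Suc L"
          using Suc.prems(1) Sn_comp_adj[OF v i(1,2)] by blast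
        moreover have "moment n (v \<circ> adj i) < moment n v"
          using moment_ascent i asc by blast
        ultimately show ?thesis
          unfolding \<psi>_def using moment_le[OF v] by linarith
      qed
      then have "\<forall>v\<in>Sn n. c' v = 0" using Suc.IH[of c'] sum0 by blast
      then have "c' (w \<circ> adj i) = 0" using Sn_comp_adj[OF w i(1,2)] by blast
      then show ?thesis using i(3) by (simp add: c'_def comp_assoc)
    qed
    have nonid: "c w = 0" if "w \<in> Sn n" "w \<noteq> id" for w
      using Sn_descent_exists[OF that] desc that(1) by metis
    have "(\<Sum>w\<in>Sn n. of_int (c w) * schubert w) = (\<Sum>w\<in>Sn n. if w = id then of_int (c w) else 0)"
      by (rule sum.cong) (use nonid schubert_id in auto)
    then have "(of_int (c id) :: mpoly) = 0" using Suc.prems(2) by simp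
    then have "c id = 0" by simp
    then show ?case using nonid by blast
  qed simp
  from this[of c "Suc (n * (n * n))"] assms show ?thesis
    unfolding \<psi>_def by (simp add: less_Suc_eq_le)
qed

section \<open>Spanning of the staircase-bounded polynomials\<close>

definition schubert_span :: "(nat \<Rightarrow> nat) set \<Rightarrow> mpoly set" where
  "schubert_span A = {\<Sum>w\<in>A. of_int (c w) * schubert w |c. True}"

lemma schubert_spanI: "(\<Sum>w\<in>A. of_int (c w) * schubert w) \<in> schubert_span A"
  unfolding schubert_span_def by blast

lemma schubert_span_0: "0 \<in> schubert_span A"
  unfolding schubert_span_def by (auto intro!: exI[of _ "\<lambda>_. 0"])

lemma schubert_span_diff: "f \<in> schubert_span A \<Longrightarrow> g \<in> schubert_span A \<Longrightarrow> f - g \<in> schubert_span A"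
proof -
  assume "f \<in> schubert_span A" "g \<in> schubert_span A"
  then obtain c d where "f = (\<Sum>w\<in>A. of_int (c w) * schubert w)" "g = (\<Sum>w\<in>A. of_int (d w) * schubert w)"
    by (auto simp: schubert_span_def)
  then have "f - g = (\<Sum>w\<in>A. of_int (c w - d w) * schubert w)"
    by (simp add: sum_subtractf algebra_simps)
  also have "\<dots> \<in> schubert_span A" by (rule schubert_spanI)
  finally show ?thesis .
qed

lemma schubert_span_add: "f \<in> schubert_span A \<Longrightarrow> g \<in> schubert_span A \<Longrightarrow> f + g \<in> schubert_span A"
  using schubert_span_diff[of f A "0 - g"] schubert_span_diff[OF schubert_span_0, of g A] by simp

lemma schubert_span_of_int_mult: "f \<in> schubert_span A \<Longrightarrow> of_int k * f \<in> schubert_span A"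
proof -
  assume "f \<in> schubert_span A"
  then obtain c where "f = (\<Sum>w\<in>A. of_int (c w) * schubert w)"
    by (auto simp: schubert_span_def)
  then have "of_int k * f = (\<Sum>w\<in>A. of_int (k * c w) * schubert w)"
    by (simp add: sum_distrib_left algebra_simps)
  also have "\<dots> \<in> schubert_span A" by (rule schubert_spanI)
  finally show ?thesis .
qed

lemma schubert_span_sum: "(\<And>x. x \<in> B \<Longrightarrow> f x \<in> schubert_span A) \<Longrightarrow> sum f B \<in> schubert_span A"
  by (induction B rule: infinite_finite_induct) (auto intro: schubert_span_0 schubert_span_add)

lemma schubert_span_schubert:
  assumes "finite A" "w \<in> A"
  shows "schubert w \<in> schubert_span A"
proof -
  have "(\<Sum>v\<in>A. of_int (if v = w then 1 else 0) * schubert v) = (\<Sum>v\<in>A. if v = w then schubert v else 0)"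
    by (rule sum.cong) auto
  then have "schubert w = (\<Sum>v\<in>A. of_int (if v = w then 1 else 0) * schubert v)"
    using assms by simp
  also have "\<dots> \<in> schubert_span A" by (rule schubert_spanI)
  finally show ?thesis .
qed

lemma schubert_span_mono:
  assumes "finite B" "A \<subseteq> B" "f \<in> schubert_span A"
  shows "f \<in> schubert_span B"
proof -
  obtain c where "f = (\<Sum>w\<in>A. of_int (c w) * schubert w)"
    using assms(3) by (auto simp: schubert_span_def)
  then show ?thesis
    using assms by (auto intro!: schubert_span_sum schubert_span_of_int_mult schubert_span_schubert)
qed

lemma mpoly_eq_sum_monom_of:
  "f = (\<Sum>m\<in>Poly_Mapping.keys f. of_int (Poly_Mapping.lookup f m) * monom_of m)"
proof (rule poly_mapping_eqI)
  fix k
  have "of_int c * monom_of m = Poly_Mapping.single m c" for c m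
    by (simp add: monom_of_def mult_single flip: Poly_Mapping.single_of_int)
  then have "Poly_Mapping.lookup (\<Sum>m\<in>Poly_Mapping.keys f. of_int (Poly_Mapping.lookup f m) * monom_of m) k
     = (\<Sum>m\<in>Poly_Mapping.keys f. if m = k then Poly_Mapping.lookup f m else 0)"
    by (simp add: lookup_sum lookup_single when_def)
  also have "\<dots> = Poly_Mapping.lookup f k"
    by (simp add: in_keys_iff)
  finally show "Poly_Mapping.lookup f k = Poly_Mapping.lookup
     (\<Sum>m\<in>Poly_Mapping.keys f. of_int (Poly_Mapping.lookup f m) * monom_of m) k" by simp
qed

text \<open>Without descents from r on, the polynomial is symmetric in x_r, x_(r+1), and so on. Its
  degrees in these variables agree, and those with large index are 0.\<close>

lemma degv_schubert_after_last_descent: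
  assumes "v \<in> Sn m" "1 \<le> r" "\<And>i. r \<le> i \<Longrightarrow> v i < v (Suc i)" "r \<le> j"
  shows "degv j (schubert v) = 0"
proof -
  have eq: "degv i (schubert v) = degv (Suc i) (schubert v)" if "r \<le> i" for i
  proof -
    have "swap_vars i (schubert v) = schubert v"
      using divided_diff_schubert_ascent[OF assms(1), of i] assms(2,3) that
      by (simp add: divided_diff_eq_0_iff)
    then show ?thesis by (metis degv_swap_vars transpose_apply_first)
  qed
  have "degv j (schubert v) = degv k (schubert v)" if "j \<le> k" for k
    using that
  proof (induction k rule: dec_induct)
    case (step k)
    then show ?case using eq[of k] assms(4) by linarith
  qed simp
  then show ?thesis
    using degv_schubert_eq_0[OF assms(1), of "max j m"] by (metis max.cobounded1 max.cobounded2)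
qed

text \<open>In terms of the Lehmer code: if \<open>v\<close> increases from r on, the code entry at
  r changes from 0 to e and all others stay.\<close>

definition move_left :: "nat \<Rightarrow> nat \<Rightarrow> (nat \<Rightarrow> nat) \<Rightarrow> nat \<Rightarrow> nat" where
  "move_left r e v j = (if j = r then v (r + e) else if r < j \<and> j \<le> r + e then v (j - 1) else v j)"

lemma move_left_increasing:
  assumes inc: "\<And>i. r \<le> i \<Longrightarrow> v i < v (Suc i)" and "r < i"
  shows "move_left r e v i < move_left r e v (Suc i)"
proof -
  have "v (i - 1) < v i" using inc[of "i - 1"] \<open>r < i\<close> by simp
  then show ?thesis using less_trans[of "v (i - 1)" "v i" "v (Suc i)"] inc[of i] \<open>r < i\<close>
    by (auto simp: move_left_def)
qed

text \<open>The leading term in \<open>x\<^sub>r\<close> that makes the spanning argument triangular: it passes from \<open>r + 1\<close> to \<open>r\<close>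
  by the symmetry of \<open>\<partial>\<^sub>r \<SS>\<^sub>w\<close> in \<open>x\<^sub>r\<close> and \<open>x\<^bsub>r+1\<^esub>\<close>.\<close>

lemma schubert_move_left:
  assumes "v \<in> Sn m" "1 \<le> r" "r + e \<le> m" "\<And>i. r \<le> i \<Longrightarrow> v i < v (Suc i)"
  shows "move_left r e v \<in> Sn m \<and>
    (schubert (move_left r e v) = X r ^ e * schubert v \<or> degv r (schubert (move_left r e v) - X r ^ e * schubert v) < e)"
  using assms(2-4)
proof (induction e arbitrary: r)
  case 0
  \<comment> \<open>For e = 0 no degree is below e, which is why the claim offers equality as an
    alternative.\<close>
  have "move_left r 0 v = v" by (auto simp: move_left_def fun_eq_iff)
  then show ?case using assms(1) by simp
next
  case (Suc e)
  let ?w = "move_left r (Suc e) v" and ?y = "move_left (Suc r) e v"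
  note inc = Suc.prems(3)
  have y: "?y \<in> Sn m"
    and L: "schubert ?y = X (Suc r) ^ e * schubert v \<or> degv (Suc r) (schubert ?y - X (Suc r) ^ e * schubert v) < e"
    using Suc.IH[of "Suc r"] Suc.prems by auto
  have wy: "?w = ?y \<circ> adj r"
    by (auto simp: fun_eq_iff move_left_def Transposition.transpose_def)
  have w: "?w \<in> Sn m"
    unfolding wy using y Suc.prems by (intro Sn_comp_adj) auto
  have mono: "v r < v (r + Suc k)" for k
  proof (induction k)
    case (Suc k)
    then show ?case using inc[of "r + Suc k"] by simp
  qed (use inc[of r] in simp)
  have "?w (Suc r) < ?w r"
    using mono[of e] by (simp add: move_left_def)
  then have dd: "divided_diff r (schubert ?w) = schubert ?y"
    using divided_diff_schubert_descent[OF w] Suc.prems wy by simp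
  define l where "l = schubert ?y - X (Suc r) ^ e * schubert v"
  have sv: "swap_vars r (schubert v) = schubert v"
    using divided_diff_schubert_ascent[OF assms(1)] Suc.prems inc by (simp add: divided_diff_eq_0_iff)
  have "schubert ?y = swap_vars r (schubert ?y)"
    by (metis dd swap_vars_divided_diff)
  also have "\<dots> = X r ^ e * schubert v + swap_vars r l"
    by (simp add: l_def swap_vars_diff swap_vars_mult swap_vars_power sv)
  finally have "schubert ?w = swap_vars r (schubert ?w) + (X r - X (Suc r)) * (X r ^ e * schubert v + swap_vars r l)"
    using divided_diff_split[of "schubert ?w" r] dd by simp
  \<comment> \<open>Each term on the right has degree at most e in x_r: \<open>?w\<close> increases
    from r+1 on, \<open>schubert v\<close> is free of x_r, and \<open>l\<close> is zero or has
    degree below e in x_(r+1).\<close>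
  then have eq: "schubert ?w - X r ^ Suc e * schubert v
     = (swap_vars r (schubert ?w) - X (Suc r) * (X r ^ e * schubert v)) + (X r - X (Suc r)) * swap_vars r l"
    by (simp add: algebra_simps)
  have "degv r (swap_vars r (schubert ?w)) = 0"
    using degv_schubert_after_last_descent[OF w, of "Suc r" "Suc r"] move_left_increasing[of r v _ "Suc e"] inc
    by (simp add: degv_swap_vars)
  moreover have "degv r (X (Suc r) * (X r ^ e * schubert v)) \<le> e"
    using degv_mult_le[of r "X (Suc r)" "X r ^ e * schubert v"] degv_mult_le[of r "X r ^ e" "schubert v"]
      degv_power_le[of r "X r" e] degv_schubert_after_last_descent[OF assms(1) Suc.prems(1) inc, of r]
    by (simp add: degv_X)
  ultimately have 1: "degv r (swap_vars r (schubert ?w) - X (Suc r) * (X r ^ e * schubert v)) \<le> e"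
    using degv_diff_le[of r "swap_vars r (schubert ?w)" "X (Suc r) * (X r ^ e * schubert v)"] by simp
  have 2: "degv r ((X r - X (Suc r)) * swap_vars r l) \<le> e"
    using L degv_mult_le[of r "X r - X (Suc r)" "swap_vars r l"]
    by (auto simp: l_def[symmetric] degv_swap_vars degv_X_diff) (simp add: l_def)
  have "degv r (schubert ?w - X r ^ Suc e * schubert v) < Suc e"
    unfolding eq using 1 2
      degv_add_le[of r "swap_vars r (schubert ?w) - X (Suc r) * (X r ^ e * schubert v)" "(X r - X (Suc r)) * swap_vars r l"]
    by linarith
  then show ?case using w by blast
qed

text \<open>Their Schubert polynomials involve no variable beyond x_r, by
  \<open>degv_schubert_after_last_descent\<close>.\<close>

definition incr_after :: "nat \<Rightarrow> nat \<Rightarrow> (nat \<Rightarrow> nat) set" where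
  "incr_after m r = {w\<in>Sn m. \<forall>i>r. w i < w (Suc i)}"

lemma finite_incr_after [simp]: "finite (incr_after m r)"
  unfolding incr_after_def by simp

text \<open>Double induction on the last variable and on its exponent e. The monomial without
  x_(r+1) is expanded first; x_(r+1)^e times each Schubert polynomial in this expansion is again a
  Schubert polynomial, up to a remainder of lower degree in x_(r+1) that still obeys the staircase
  bound.\<close>

lemma monom_of_in_schubert_span:
  assumes "\<And>j. Poly_Mapping.lookup a j \<le> (if j = 0 then 0 else m - j)" "\<And>j. j > r \<Longrightarrow> Poly_Mapping.lookup a j = 0"
  shows "monom_of a \<in> schubert_span (incr_after m r)"
  using assms
proof (induction r arbitrary: a)
  case 0
  have "a = 0"
  proof (rule poly_mapping_eqI)
    fix j show "Poly_Mapping.lookup a j = Poly_Mapping.lookup 0 j"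
      using "0.prems"(1)[of 0] "0.prems"(2)[of j] by (cases j) auto
  qed
  then have "monom_of a = schubert id" by (simp add: monom_of_def schubert_id)
  moreover have "id \<in> incr_after m 0" by (simp add: incr_after_def)
  ultimately show ?case using schubert_span_schubert by simp
next
  case (Suc r)
  note outer = Suc.IH
  show ?case
    using Suc.prems
  proof (induction "Poly_Mapping.lookup a (Suc r)" arbitrary: a rule: less_induct)
    case less
    define e where "e = Poly_Mapping.lookup a (Suc r)"
    define b where "b = a - Poly_Mapping.single (Suc r) e"
    have lookup_b: "Poly_Mapping.lookup b j = (if j = Suc r then 0 else Poly_Mapping.lookup a j)" for j
      by (auto simp: b_def e_def lookup_minus lookup_single when_def)
    have "a = Poly_Mapping.single (Suc r) e + b"
      by (rule poly_mapping_eqI) (auto simp: lookup_add lookup_b lookup_single e_def when_def)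
    moreover have "monom_of (Poly_Mapping.single (Suc r) e) = X (Suc r) ^ e"
    proof (induction e)
      case (Suc e)
      have "Poly_Mapping.single (Suc r) (Suc e) = Poly_Mapping.single (Suc r) 1 + Poly_Mapping.single (Suc r) e"
        by (simp flip: single_add)
      then show ?case using Suc.IH by (simp only: monom_of_mult power_Suc) (simp add: X_def monom_of_def)
    qed (simp add: monom_of_def)
    ultimately have mon: "monom_of a = X (Suc r) ^ e * monom_of b"
      by (metis monom_of_mult)
    have b_in: "monom_of b \<in> schubert_span (incr_after m r)"
    proof (rule outer)
      show "Poly_Mapping.lookup b j \<le> (if j = 0 then 0 else m - j)" for j
        using less.prems(1)[of j] by (cases "j = Suc r") (simp_all add: lookup_b)
      show "Poly_Mapping.lookup b j = 0" if "r < j" for j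
        using less.prems(2)[of j] that by (auto simp: lookup_b)
    qed
    show ?case
    proof (cases "e = 0")
      case True
      have "incr_after m r \<subseteq> incr_after m (Suc r)" by (auto simp: incr_after_def)
      with True mon b_in show ?thesis by (auto intro: schubert_span_mono)
    next
      case False
      have em: "Suc r + e \<le> m" using less.prems(1)[of "Suc r"] False by (simp add: e_def)
      have step: "X (Suc r) ^ e * schubert v \<in> schubert_span (incr_after m (Suc r))" if v: "v \<in> incr_after m r" for v
      proof -
        have vS: "v \<in> Sn m" and inc: "\<And>i. Suc r \<le> i \<Longrightarrow> v i < v (Suc i)"
          using v by (auto simp: incr_after_def)
        let ?w = "move_left (Suc r) e v"
        define l where "l = schubert ?w - X (Suc r) ^ e * schubert v"
        have w: "?w \<in> Sn m" and l: "l = 0 \<or> degv (Suc r) l < e"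
          using schubert_move_left[OF vS _ em inc] by (auto simp: l_def)
        have "?w \<in> incr_after m (Suc r)"
          using w move_left_increasing[of "Suc r" v _ e] inc by (auto simp: incr_after_def)
        then have w_in: "schubert ?w \<in> schubert_span (incr_after m (Suc r))" by (simp add: schubert_span_schubert)
        have degl: "degv j l \<le> max (degv j (schubert ?w)) (e * degv j (X (Suc r)) + degv j (schubert v))" for j
          using degv_diff_le[of j "schubert ?w" "X (Suc r) ^ e * schubert v"]
            degv_mult_le[of j "X (Suc r) ^ e" "schubert v"] degv_power_le[of j "X (Suc r)" e]
          unfolding l_def by linarith
        have dv0: "degv j (schubert v) = 0" if "Suc r \<le> j" for j
          using degv_schubert_after_last_descent[OF vS _ inc, of "Suc r" j] that by auto
        have dw0: "degv j (schubert ?w) = 0" if "Suc r < j" for j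
          using degv_schubert_after_last_descent[OF w, of "Suc (Suc r)" j] move_left_increasing[of "Suc r" v _ e] inc that by auto
        have "monom_of k \<in> schubert_span (incr_after m (Suc r))" if k: "k \<in> Poly_Mapping.keys l" for k
        proof (rule less.hyps)
          have lk: "Poly_Mapping.lookup k j \<le> degv j l" for j using k by (rule lookup_le_degv)
          have "l \<noteq> 0" using k by auto
          then show "Poly_Mapping.lookup k (Suc r) < Poly_Mapping.lookup a (Suc r)"
            using l lk[of "Suc r"] by (simp add: e_def)
          show "Poly_Mapping.lookup k j \<le> (if j = 0 then 0 else m - j)" for j
            using lk[of j] degl[of j] staircase_bounded_schubert[OF w, unfolded staircase_bounded_def, rule_format, of j]
              staircase_bounded_schubert[OF vS, unfolded staircase_bounded_def, rule_format, of j] dv0[of j] em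
            by (cases "j = Suc r") (auto simp: degv_X)
          show "Poly_Mapping.lookup k j = 0" if "Suc r < j" for j
            using lk[of j] degl[of j] dv0[of j] dw0[of j] that by (simp add: degv_X)
        qed
        then have "l \<in> schubert_span (incr_after m (Suc r))"
          by (subst mpoly_eq_sum_monom_of) (intro schubert_span_sum schubert_span_of_int_mult)
        from schubert_span_diff[OF w_in this] show ?thesis by (simp add: l_def)
      qed
      obtain c where "monom_of b = (\<Sum>v\<in>incr_after m r. of_int (c v) * schubert v)"
        using b_in by (auto simp: schubert_span_def)
      then have "monom_of a = (\<Sum>v\<in>incr_after m r. of_int (c v) * (X (Suc r) ^ e * schubert v))"
        unfolding mon by (simp add: sum_distrib_left algebra_simps)
      then show ?thesis by (simp add: schubert_span_sum schubert_span_of_int_mult step)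
    qed
  qed
qed

lemma staircase_bounded_imp_schubert_span:
  assumes "staircase_bounded m f"
  shows "f \<in> schubert_span (Sn m)"
proof -
  have "monom_of k \<in> schubert_span (Sn m)" if k: "k \<in> Poly_Mapping.keys f" for k
  proof (rule schubert_span_mono[OF finite_Sn])
    have lk: "Poly_Mapping.lookup k j \<le> (if j = 0 then 0 else m - j)" for j
      using lookup_le_degv[OF k, of j] assms unfolding staircase_bounded_def by (meson order_trans)
    show "monom_of k \<in> schubert_span (incr_after m m)"
    proof (rule monom_of_in_schubert_span[OF lk])
      show "Poly_Mapping.lookup k j = 0" if "m < j" for j
        using lk[of j] that by (simp split: if_splits)
    qed
  qed (auto simp: incr_after_def)
  then show ?thesis
    by (subst mpoly_eq_sum_monom_of) (intro schubert_span_sum schubert_span_of_int_mult)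
qed

lemma staircase_bounded_mono: "staircase_bounded m f \<Longrightarrow> m \<le> n \<Longrightarrow> staircase_bounded n f"
  unfolding staircase_bounded_def by (smt (verit, best) diff_le_mono le_trans)

lemma staircase_bounded_mult: "staircase_bounded n f \<Longrightarrow> staircase_bounded n g \<Longrightarrow> staircase_bounded (n + n) (f * g)"
  unfolding staircase_bounded_def
proof
  fix j assume a: "\<forall>j. degv j f \<le> (if j = 0 then 0 else n - j)" "\<forall>j. degv j g \<le> (if j = 0 then 0 else n - j)"
  show "degv j (f * g) \<le> (if j = 0 then 0 else n + n - j)"
    using degv_mult_le[of j f g] a[rule_format, of j] by (auto split: if_splits)
qed

section \<open>Structure constants and the staircase bound\<close>

lemma finite_subset_Sinf: "finite A \<Longrightarrow> A \<subseteq> Sinf \<Longrightarrow> \<exists>n. A \<subseteq> Sn n"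
proof (induction A rule: finite_induct)
  case (insert w A)
  then obtain n k where "A \<subseteq> Sn n" "w \<in> Sn k" unfolding Sinf_def by blast
  then have "insert w A \<subseteq> Sn (max n k)"
    using Sn_mono[of n "max n k"] Sn_mono[of k "max n k"] by auto
  then show ?case by blast
qed simp

lemma schubert_coeff_eqI:
  assumes c: "{w. c w \<noteq> 0} \<subseteq> Sn m" "schubert u * schubert v = (\<Sum>w\<in>Sn m. of_int (c w) * schubert w)"
  shows "schubert_coeff u v = c"
  unfolding schubert_coeff_def
proof (rule the_equality, intro conjI)
  have supp: "(\<Sum>w\<in>{w. d w \<noteq> 0}. of_int (d w) * schubert w) = (\<Sum>w\<in>Sn k. of_int (d w) * schubert w)"
    if "{w. d w \<noteq> 0} \<subseteq> Sn k" for d :: "(nat \<Rightarrow> nat) \<Rightarrow> int" and k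
    by (rule sum.mono_neutral_left[OF finite_Sn that]) simp
  show "finite {w. c w \<noteq> 0}" using c(1) finite_Sn by (rule finite_subset)
  show "{w. c w \<noteq> 0} \<subseteq> Sinf" using c(1) unfolding Sinf_def by blast
  show "schubert u * schubert v = (\<Sum>w\<in>{w. c w \<noteq> 0}. of_int (c w) * schubert w)"
    unfolding supp[OF c(1)] by (rule c(2))
  fix d assume d: "finite {w. d w \<noteq> 0} \<and> {w. d w \<noteq> 0} \<subseteq> Sinf \<and>
     schubert u * schubert v = (\<Sum>w\<in>{w. d w \<noteq> 0}. of_int (d w) * schubert w)"
  then obtain k where k: "{w. d w \<noteq> 0} \<subseteq> Sn k" using finite_subset_Sinf by metis
  define N where "N = max m k"
  have cN: "{w. c w \<noteq> 0} \<subseteq> Sn N" and dN: "{w. d w \<noteq> 0} \<subseteq> Sn N"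
    using c(1) k Sn_mono[of m N] Sn_mono[of k N] by (auto simp: N_def)
  have "(\<Sum>w\<in>Sn N. of_int (d w - c w) * schubert w) =
      (\<Sum>w\<in>Sn N. of_int (d w) * schubert w) - (\<Sum>w\<in>Sn N. of_int (c w) * schubert w)"
    by (simp add: algebra_simps sum_subtractf)
  also have "\<dots> = 0"
    unfolding supp[OF cN, symmetric] supp[OF dN, symmetric] supp[OF c(1)]
    using d c(2) supp[OF c(1)] by (metis (no_types, lifting) eq_iff_diff_eq_0)
  finally have *: "(\<Sum>w\<in>Sn N. of_int (d w - c w) * schubert w) = 0" .
  show "d = c"
  proof
    fix w show "d w = c w"
    proof (cases "w \<in> Sn N")
      case True
      then show ?thesis using schubert_independent[OF * True] by simp
    next
      case False
      then have "c w = 0" "d w = 0" using cN dN by blast+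
      then show ?thesis by simp
    qed
  qed
qed

lemma schubert_coeff_in_Sn_iff:
  assumes "u \<in> Sn n" "v \<in> Sn n"
  shows "(\<forall>w. schubert_coeff u v w \<noteq> 0 \<longrightarrow> w \<in> Sn m) \<longleftrightarrow> staircase_bounded m (schubert u * schubert v)"
proof -
  have get: "\<exists>c. {w. c w \<noteq> 0} \<subseteq> Sn k \<and> schubert u * schubert v = (\<Sum>w\<in>Sn k. of_int (c w) * schubert w)"
    if st: "staircase_bounded k (schubert u * schubert v)" for k
  proof -
    obtain c where c: "schubert u * schubert v = (\<Sum>w\<in>Sn k. of_int (c w) * schubert w)"
      using staircase_bounded_imp_schubert_span[OF st] by (auto simp: schubert_span_def)
    then have "schubert u * schubert v = (\<Sum>w\<in>Sn k. of_int (if w \<in> Sn k then c w else 0) * schubert w)"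
      by simp
    then show ?thesis by (intro exI[of _ "\<lambda>w. if w \<in> Sn k then c w else 0"]) auto
  qed
  show ?thesis
  proof
    assume "staircase_bounded m (schubert u * schubert v)"
    from get[OF this] show "\<forall>w. schubert_coeff u v w \<noteq> 0 \<longrightarrow> w \<in> Sn m"
      using schubert_coeff_eqI by blast
  next
    assume L: "\<forall>w. schubert_coeff u v w \<noteq> 0 \<longrightarrow> w \<in> Sn m"
    \<comment> \<open>Some finite expansion is needed first to identify the structure constants, and
      the group on 2n points always provides one.\<close>
    have "staircase_bounded (n + n) (schubert u * schubert v)"
      using assms by (intro staircase_bounded_mult staircase_bounded_schubert)
    then obtain c where c: "{w. c w \<noteq> 0} \<subseteq> Sn (n + n)"
        "schubert u * schubert v = (\<Sum>w\<in>Sn (n + n). of_int (c w) * schubert w)"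
      using get by blast
    then have cm: "w \<in> Sn m" if "c w \<noteq> 0" for w
      using schubert_coeff_eqI[OF c] L that by blast
    show "staircase_bounded m (schubert u * schubert v)"
      unfolding staircase_bounded_def c(2)
    proof (rule allI, rule degv_sum_le)
      fix j w
      show "degv j (of_int (c w) * schubert w) \<le> (if j = 0 then 0 else m - j)"
      proof (cases "c w = 0")
        case False
        then show ?thesis
          using degv_mult_le[of j "of_int (c w)" "schubert w"]
            staircase_bounded_schubert[OF cm[OF False], unfolded staircase_bounded_def, rule_format, of j] by simp
      qed simp
    qed
  qed
qed

text \<open>The Hardt-Wallach maximum with \<open>i\<close> shifted by one, and with the range extended to \<open>n\<close>: it differs from
  \<^const>\<open>FS\<close> only if both permutations fix \<open>n\<close>.\<close>

definition HW :: "nat \<Rightarrow> (nat \<Rightarrow> nat) \<Rightarrow> (nat \<Rightarrow> nat) \<Rightarrow> nat" where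
  "HW n u v = Max ((\<lambda>i. Lam n u (Suc i) + Lam n v (Suc i) + i) ` {0..n})"

section \<open>Forward stability as the Hardt-Wallach maximum\<close>

lemma HW_ge: "i \<le> n \<Longrightarrow> Lam n u (Suc i) + Lam n v (Suc i) + i \<le> HW n u v"
  unfolding HW_def by (intro Max_ge) auto

lemma Lam_le: "Lam n w (Suc i) \<le> n - i"
proof -
  have "Lam n w (Suc i) \<le> card {Suc i..n}" unfolding Lam_def by (rule card_mono) auto
  then show ?thesis by simp
qed

lemma HW_le: "HW n u v \<le> 2 * n"
  unfolding HW_def
proof (intro Max.boundedI)
  fix x assume "x \<in> (\<lambda>i. Lam n u (Suc i) + Lam n v (Suc i) + i) ` {0..n}"
  then obtain i where "i \<le> n" "x = Lam n u (Suc i) + Lam n v (Suc i) + i" by auto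
  then show "x \<le> 2 * n" using Lam_le[of n u i] Lam_le[of n v i] by linarith
qed auto

lemma FS_facts:
  assumes "u \<in> Sn n" "v \<in> Sn n"
  shows "1 \<le> FS u v" "staircase_bounded (FS u v) (schubert u * schubert v)"
    "1 \<le> m \<Longrightarrow> staircase_bounded m (schubert u * schubert v) \<Longrightarrow> FS u v \<le> m"
proof -
  have FS: "FS u v = (LEAST m. m \<ge> 1 \<and> staircase_bounded m (schubert u * schubert v))"
    unfolding FS_def schubert_coeff_in_Sn_iff[OF assms] ..
  have "staircase_bounded (n + n) (schubert u * schubert v)"
    using assms by (intro staircase_bounded_mult staircase_bounded_schubert)
  then have "staircase_bounded (n + n + 1) (schubert u * schubert v)"
    by (rule staircase_bounded_mono) simp
  then have "n + n + 1 \<ge> 1 \<and> staircase_bounded (n + n + 1) (schubert u * schubert v)" by simp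
  from LeastI[of "\<lambda>m. m \<ge> 1 \<and> staircase_bounded m (schubert u * schubert v)", OF this]
  show "1 \<le> FS u v" "staircase_bounded (FS u v) (schubert u * schubert v)" unfolding FS by auto
  show "FS u v \<le> m" if "1 \<le> m" "staircase_bounded m (schubert u * schubert v)"
    unfolding FS using that by (intro Least_le) auto
qed

lemma FS_le_HW:
  assumes uv: "u \<in> Sn n" "v \<in> Sn n" and "1 \<le> n"
  shows "FS u v \<le> HW n u v"
proof (rule FS_facts(3)[OF uv])
  show "1 \<le> HW n u v" using HW_ge[of n n u v] \<open>1 \<le> n\<close> by simp
  show "staircase_bounded (HW n u v) (schubert u * schubert v)"
    unfolding staircase_bounded_def
  proof
    fix j
    have "degv j (schubert u * schubert v) \<le> degv j (schubert u) + degv j (schubert v)"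
      by (rule degv_mult_le)
    then show "degv j (schubert u * schubert v) \<le> (if j = 0 then 0 else HW n u v - j)"
      using degv_schubert_le[OF uv(1), of j] degv_schubert_le[OF uv(2), of j] HW_ge[of j n u v]
        degv_schubert_eq_0[OF uv(1), of j] degv_schubert_eq_0[OF uv(2), of j]
        staircase_bounded_schubert[OF uv(1), unfolded staircase_bounded_def, rule_format, of j]
        staircase_bounded_schubert[OF uv(2), unfolded staircase_bounded_def, rule_format, of j]
      by (cases "j = 0"; cases "j \<le> n") auto
  qed
qed

lemma Sn_record_n:
  assumes "w \<in> Sn n" "1 \<le> n" "\<not> nonrec w n"
  shows "w n = n"
proof -
  have "n \<in> w ` {1..n}" using assms(1,2) unfolding Sn_def by (auto simp: permutes_image)
  then obtain k where k: "1 \<le> k" "k \<le> n" "w k = n" by force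
  have "w k \<le> w n" using assms(3) k(2) unfolding nonrec_def by (metis le_less not_less)
  then show ?thesis using k Sn_in[OF assms(1), of n] assms(2) by simp
qed

lemma FS_eq_HW:
  assumes uv: "u \<in> Sn n" "v \<in> Sn n" and n: "1 \<le> n" and not_fixed: "\<not> (u n = n \<and> v n = n)"
  shows "FS u v = HW n u v"
proof -
  define val where "val i = Lam n u (Suc i) + Lam n v (Suc i) + i" for i
  have "HW n u v \<in> val ` {0..n}"
    unfolding HW_def val_def by (rule Max_in) auto
  then have ex: "\<exists>i. i \<le> n \<and> val i = HW n u v" by force
  define i where "i = (LEAST i. i \<le> n \<and> val i = HW n u v)"
  have i: "i \<le> n" "val i = HW n u v"
    using LeastI_ex[OF ex] by (auto simp: i_def)
  have least: "val k < HW n u v" if "k < i" for k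
    using not_less_Least[of k "\<lambda>i. i \<le> n \<and> val i = HW n u v"] that i HW_ge[of k n u v]
    by (fastforce simp: i_def val_def)
  have rec1: "\<not> nonrec u 1" "\<not> nonrec v 1"
    using Sn_zero_fixed[OF uv(1)] Sn_zero_fixed[OF uv(2)] by (auto simp: nonrec_def)
  have "i \<noteq> 0"
  proof
    assume "i = 0"
    then have "val 1 = val i + 1"
      using Lam_Suc[of 1 n u] Lam_Suc[of 1 n v] rec1 n by (simp add: val_def)
    then show False using i HW_ge[of 1 n u v] n by (simp add: val_def)
  qed
  then have i1: "1 \<le> i" by simp
  \<comment> \<open>From i-1 to i the value changes by 1 minus the number of u, v without a record
    at i, so an increase forces a record of both.\<close>
  have "val (i - 1) < val i" using least[of "i - 1"] i1 i by simp
  then have rec: "\<not> nonrec u i" "\<not> nonrec v i"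
    using Lam_Suc[of i n u] Lam_Suc[of i n v] i i1 by (auto simp: val_def split: if_splits)
  define d where "d = degv i (schubert u * schubert v)"
  have dL: "d = Lam n u (Suc i) + Lam n v (Suc i)"
    unfolding d_def
    using degv_schubert_record[OF uv(1) i1 rec(1)] degv_schubert_record[OF uv(2) i1 rec(2)]
      degv_mult[OF schubert_neq_0[OF uv(1)] schubert_neq_0[OF uv(2)], of i] by simp
  \<comment> \<open>The subtraction in \<open>d \<le> FS u v - i\<close> is truncated, so d + i is
    bounded by \<open>FS u v\<close> only for positive d. If d were 0, then n would be a record of
    both permutations, and both would fix n.\<close>
  have "d \<noteq> 0"
  proof
    assume "d = 0"
    then have L: "Lam n u (Suc i) = 0" "Lam n v (Suc i) = 0" using dL by auto
    have "\<not> nonrec w n" if "Lam n w (Suc i) = 0" "\<not> nonrec w i" for w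
    proof (cases "i = n")
      case False
      then have "n \<in> {Suc i..n}" using i by auto
      then show ?thesis using that(1) unfolding Lam_def by auto
    qed (use that in simp)
    then show False using not_fixed Sn_record_n uv n L rec by blast
  qed
  moreover have "d \<le> FS u v - i"
    using FS_facts(2)[OF uv] i1 unfolding d_def staircase_bounded_def by (metis not_one_le_zero)
  ultimately have "HW n u v \<le> FS u v" using i(2) dL unfolding val_def by linarith
  then show ?thesis using FS_le_HW[OF uv n] by simp
qed

subsection \<open>Records of uniform permutations\<close>

definition recs :: "nat \<Rightarrow> (nat \<Rightarrow> nat) \<Rightarrow> nat set" where
  "recs n w = {j\<in>{1..n}. \<not> nonrec w j}"

lemma recs_subset: "recs n w \<subseteq> {1..n}"
  by (auto simp: recs_def)

lemma finite_recs [simp]: "finite (recs n w)"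
  by (simp add: recs_def)

text \<open>A permutation of \<open>{1..n+1}\<close> corresponds to its last value \<open>k\<close> and the relative order \<open>w\<close> of its first
  \<open>n\<close> values. The latter determines the records up to \<open>n\<close>, the former whether \<open>n + 1\<close> is one.\<close>

definition shift :: "nat \<Rightarrow> nat \<Rightarrow> nat \<Rightarrow> nat" where
  "shift n k x = (if x = Suc n then k else if k \<le> x \<and> x \<le> n then Suc x else x)"

definition append_value :: "nat \<Rightarrow> nat \<Rightarrow> (nat \<Rightarrow> nat) \<Rightarrow> nat \<Rightarrow> nat" where
  "append_value n k w = shift n k \<circ> w"

lemma shift_permutes:
  assumes "k \<in> {1..Suc n}"
  shows "shift n k permutes {1..Suc n}"
proof (rule bij_imp_permutes)
  have "inj_on (shift n k) {1..Suc n}"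
    using assms by (auto simp: inj_on_def shift_def split: if_splits)
  moreover have "shift n k ` {1..Suc n} \<subseteq> {1..Suc n}"
    using assms by (auto simp: shift_def)
  ultimately show "bij_betw (shift n k) {1..Suc n} {1..Suc n}"
    unfolding bij_betw_def using endo_inj_surj[of "{1..Suc n}" "shift n k"] by simp
qed (use assms in \<open>auto simp: shift_def\<close>)

lemma shift_less_iff: "x \<le> n \<Longrightarrow> y \<le> n \<Longrightarrow> shift n k x < shift n k y \<longleftrightarrow> x < y"
  by (auto simp: shift_def)

lemma append_value_last: "w \<in> Sn n \<Longrightarrow> append_value n k w (Suc n) = k"
  using Sn_fixed[of w n "Suc n"] by (simp add: append_value_def shift_def)

lemma append_value_in_Sn: "k \<in> {1..Suc n} \<Longrightarrow> w \<in> Sn n \<Longrightarrow> append_value n k w \<in> Sn (Suc n)"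
  using permutes_compose[OF _ shift_permutes, of w n k] permutes_subset[of w "{1..n}" "{1..Suc n}"]
  by (simp add: Sn_def append_value_def)

lemma Sn_le: "w \<in> Sn n \<Longrightarrow> j \<le> n \<Longrightarrow> w j \<le> n"
  using Sn_in[of w n j] Sn_zero_fixed[of w n] by (cases "j = 0") auto

lemma nonrec_append_value:
  assumes "w \<in> Sn n" "j \<le> n"
  shows "nonrec (append_value n k w) j \<longleftrightarrow> nonrec w j"
  unfolding nonrec_def append_value_def o_def
proof (rule iff_exI)
  fix i
  show "(i < j \<and> shift n k (w j) < shift n k (w i)) = (i < j \<and> w j < w i)"
  proof (cases "i < j")
    case True
    then show ?thesis
      using shift_less_iff[OF Sn_le[OF assms(1,2)] Sn_le[OF assms(1), of i], of k] assms(2) by simp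
  qed simp
qed

lemma nonrec_append_value_last:
  assumes "w \<in> Sn n" "k \<in> {1..Suc n}"
  shows "nonrec (append_value n k w) (Suc n) \<longleftrightarrow> k \<noteq> Suc n"
proof
  assume "nonrec (append_value n k w) (Suc n)"
  then obtain i where i: "i < Suc n" "k < append_value n k w i" by (auto simp: nonrec_def append_value_last[OF assms(1)])
  then show "k \<noteq> Suc n"
    using Sn_le[OF append_value_in_Sn[OF assms(2,1)], of i] by auto
next
  assume "k \<noteq> Suc n"
  then have k: "1 \<le> k" "k \<le> n" using assms(2) by auto
  have "n \<in> w ` {1..n}" using assms(1) k unfolding Sn_def by (auto simp: permutes_image)
  then obtain i where "i \<in> {1..n}" "w i = n" by auto
  then have "i < Suc n" "k < append_value n k w i" using k by (auto simp: append_value_def shift_def)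
  then show "nonrec (append_value n k w) (Suc n)" unfolding nonrec_def append_value_last[OF assms(1)] by blast
qed

lemma recs_append_value:
  assumes "w \<in> Sn n" "k \<in> {1..Suc n}"
  shows "recs (Suc n) (append_value n k w) = (if k = Suc n then insert (Suc n) (recs n w) else recs n w)"
proof -
  have "{1..Suc n} = insert (Suc n) {1..n}" by auto
  then show ?thesis
    using nonrec_append_value[OF assms(1)] nonrec_append_value_last[OF assms]
    unfolding recs_def by (auto simp del: atLeastAtMost_iff) auto
qed

section \<open>Averages over record sets\<close>

lemma card_Sn: "card (Sn n) = fact n"
  unfolding Sn_def by (rule card_permutations) auto

lemma bij_append_value: "bij_betw (\<lambda>(k, w). append_value n k w) ({1..Suc n} \<times> Sn n) (Sn (Suc n))"
proof -
  have inj: "inj_on (\<lambda>(k, w). append_value n k w) ({1..Suc n} \<times> Sn n)"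
  proof (rule inj_onI, clarify)
    fix k w k' w'
    assume *: "k \<in> {1..Suc n}" "w \<in> Sn n" "k' \<in> {1..Suc n}" "w' \<in> Sn n" "append_value n k w = append_value n k' w'"
    then have k: "k = k'" using append_value_last by metis
    have "inj (shift n k)" using permutes_inj[OF shift_permutes[OF *(1)]] .
    then have "w = w'" using *(5) unfolding k append_value_def by (auto simp: fun_eq_iff dest: injD)
    with k show "k = k' \<and> w = w'" by simp
  qed
  have sub: "(\<lambda>(k, w). append_value n k w) ` ({1..Suc n} \<times> Sn n) \<subseteq> Sn (Suc n)"
    using append_value_in_Sn by auto
  have "card ((\<lambda>(k, w). append_value n k w) ` ({1..Suc n} \<times> Sn n)) = card (Sn (Suc n))"
    unfolding card_image[OF inj] by (simp add: card_cartesian_product card_Sn)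
  then have "(\<lambda>(k, w). append_value n k w) ` ({1..Suc n} \<times> Sn n) = Sn (Suc n)"
    using sub by (intro card_subset_eq) auto
  with inj show ?thesis unfolding bij_betw_def ..
qed

text \<open>The expectation of \<open>F\<close> at the record set of a uniform permutation; the
  value field is left open since means are real and characteristic functions complex.\<close>

definition recE :: "nat \<Rightarrow> (nat set \<Rightarrow> 'a::real_normed_field) \<Rightarrow> 'a" where
  "recE n F = (\<Sum>w\<in>Sn n. F (recs n w)) / fact n"

lemma recE_0: "recE 0 F = F {}"
proof -
  have "Sn 0 = {id}" by (auto simp: Sn_def)
  then show ?thesis by (simp add: recE_def recs_def)
qed

text \<open>This encodes the independence of records: one of the n+1 equally likely last values
  makes n+1 a record, whatever the earlier records are.\<close>

lemma recE_Suc: "recE (Suc n) F = (recE n (\<lambda>A. F (insert (Suc n) A)) + of_nat n * recE n F) / of_nat (Suc n)"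
proof -
  have "(\<Sum>w\<in>Sn (Suc n). F (recs (Suc n) w)) = (\<Sum>(k, w)\<in>{1..Suc n} \<times> Sn n. F (recs (Suc n) (append_value n k w)))"
    by (subst sum.reindex_bij_betw[OF bij_append_value, symmetric]) (simp add: case_prod_unfold)
  also have "\<dots> = (\<Sum>k=1..Suc n. \<Sum>w\<in>Sn n. F (recs (Suc n) (append_value n k w)))"
    by (rule sum.cartesian_product[symmetric])
  also have "\<dots> = (\<Sum>k=1..Suc n. \<Sum>w\<in>Sn n. F (if k = Suc n then insert (Suc n) (recs n w) else recs n w))"
    by (intro sum.cong refl) (simp add: recs_append_value)
  also have "\<dots> = (\<Sum>w\<in>Sn n. F (insert (Suc n) (recs n w))) + of_nat n * (\<Sum>w\<in>Sn n. F (recs n w))"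
    by simp
  finally show ?thesis
    unfolding recE_def by (simp add: field_simps)
qed

lemma recE_cong: "(\<And>A. A \<subseteq> {1..n} \<Longrightarrow> F A = G A) \<Longrightarrow> recE n F = recE n G"
  unfolding recE_def using recs_subset by (metis (no_types, lifting) sum.cong)

lemma recE_const [simp]: "recE n (\<lambda>_. c) = c"
  unfolding recE_def by (simp add: card_Sn)

lemma recE_add: "recE n (\<lambda>A. F A + G A) = recE n F + recE n G"
  unfolding recE_def by (simp add: sum.distrib add_divide_distrib)

lemma recE_diff: "recE n (\<lambda>A. F A - G A) = recE n F - recE n G"
  unfolding recE_def by (simp add: sum_subtractf diff_divide_distrib)

lemma recE_mult_left: "recE n (\<lambda>A. c * F A) = c * recE n F"
  unfolding recE_def by (simp add: sum_distrib_left)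

lemma recE_mult_right: "recE n (\<lambda>A. F A * c) = recE n F * c"
  unfolding recE_def by (simp add: sum_distrib_right)

lemma recE_sum: "recE n (\<lambda>A. \<Sum>i\<in>I. F i A) = (\<Sum>i\<in>I. recE n (F i))"
  by (induction I rule: infinite_finite_induct) (simp_all add: recE_add)

lemma recE_mono:
  fixes F :: "nat set \<Rightarrow> real"
  shows "(\<And>A. A \<subseteq> {1..n} \<Longrightarrow> F A \<le> G A) \<Longrightarrow> recE n F \<le> recE n G"
  unfolding recE_def by (intro divide_right_mono sum_mono) (use recs_subset in blast, simp)

lemma recE_Suc_mono:
  fixes F :: "nat set \<Rightarrow> real"
  assumes "\<And>A. A \<subseteq> {1..n} \<Longrightarrow> F A \<le> G (insert (Suc n) A)" "\<And>A. A \<subseteq> {1..n} \<Longrightarrow> F A \<le> G A"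
  shows "recE n F \<le> recE (Suc n) G"
proof -
  have "recE n F \<le> recE n (\<lambda>A. G (insert (Suc n) A))" "real n * recE n F \<le> real n * recE n G"
    using assms by (intro mult_left_mono recE_mono; simp)+
  then show ?thesis
    unfolding recE_Suc by (simp add: field_simps)
qed

lemma recE_mem: "recE n (\<lambda>A. if j \<in> A then 1 else 0) = (if 1 \<le> j \<and> j \<le> n then 1 / of_nat j else 0)"
proof (induction n)
  case 0
  then show ?case by (simp add: recE_0)
next
  case (Suc n)
  show ?case
  proof (cases "j = Suc n")
    case True
    then show ?thesis using Suc by (simp add: recE_Suc)
  next
    case False
    have "(1 / of_nat j + of_nat n * (1 / of_nat j)) / of_nat (Suc n) = (1 / of_nat j :: 'a)"
    proof -
      have "1 / of_nat j + of_nat n * (1 / of_nat j) = of_nat (Suc n) * (1 / of_nat j :: 'a)"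
        by (simp add: add_divide_distrib)
      then show ?thesis by (simp only: nonzero_mult_div_cancel_left of_nat_neq_0 not_False_eq_True)
    qed
    with False show ?thesis using Suc by (simp add: recE_Suc del: of_nat_Suc)
  qed
qed

lemma recE_card: "recE n (\<lambda>A. of_nat (card A)) = harm n"
proof -
  have "recE n (\<lambda>A. of_nat (card A)) = recE n (\<lambda>A. \<Sum>j=1..n. if j \<in> A then 1 else 0 :: 'a)"
  proof (rule recE_cong)
    fix A assume "A \<subseteq> {1..n}"
    then have "{1..n} \<inter> A = A" by auto
    then show "of_nat (card A) = (\<Sum>j=1..n. if j \<in> A then 1 else 0 :: 'a)"
      by (simp add: sum.If_cases)
  qed
  then show ?thesis
    unfolding recE_sum recE_mem by (simp add: harm_def field_simps)
qed

text \<open>The generating function of a sum of independent indicators with success probabilities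
  1/j.\<close>

lemma recE_power_card: "recE n (\<lambda>A. z ^ card A) = (\<Prod>j=1..n. 1 + (z - 1) / of_nat j)"
proof (induction n)
  case 0
  then show ?case by (simp add: recE_0)
next
  case (Suc n)
  have "recE n (\<lambda>A. z ^ card (insert (Suc n) A)) = recE n (\<lambda>A. z * z ^ card A)"
  proof (rule recE_cong)
    fix A assume "A \<subseteq> {1..n}"
    then have "finite A" "Suc n \<notin> A" using finite_subset by auto
    then show "z ^ card (insert (Suc n) A) = z * z ^ card A" by simp
  qed
  then have "recE (Suc n) (\<lambda>A. z ^ card A) = recE n (\<lambda>A. z ^ card A) * ((z + of_nat n) / of_nat (Suc n))"
    unfolding recE_Suc recE_mult_left by (simp add: algebra_simps add_divide_distrib)
  also have "(z + of_nat n) / of_nat (Suc n) = 1 + (z - 1) / of_nat (Suc n)"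
    by (simp add: field_simps del: of_nat_Suc) (simp add: algebra_simps)
  finally show ?case using Suc.IH by simp
qed

text \<open>The maximum of the walk with steps \<open>\<rho>\<^sub>j(u) + \<rho>\<^sub>j(v) - 1\<close>, where \<open>\<rho>\<^sub>j\<close> indicates a record at \<open>j\<close>.\<close>

definition walk_max :: "nat \<Rightarrow> nat set \<Rightarrow> nat set \<Rightarrow> real" where
  "walk_max n A B = Max ((\<lambda>i. real (card (A \<inter> {1..i})) + real (card (B \<inter> {1..i})) - real i) ` {0..n})"

section \<open>The walk driven by common records\<close>

lemma walk_max_ge: "i \<le> n \<Longrightarrow> real (card (A \<inter> {1..i})) + real (card (B \<inter> {1..i})) - real i \<le> walk_max n A B"
  unfolding walk_max_def by (intro Max_ge) auto

lemma walk_max_nonneg: "0 \<le> walk_max n A B"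
  using walk_max_ge[of 0 n A B] by simp

lemma walk_max_ge_1: "1 \<le> n \<Longrightarrow> 1 \<in> A \<Longrightarrow> 1 \<in> B \<Longrightarrow> 1 \<le> walk_max n A B"
proof -
  assume *: "1 \<le> n" "1 \<in> A" "1 \<in> B"
  then have "A \<inter> {1..1} = {1}" "B \<inter> {1..1} = {1}" by auto
  then show ?thesis using walk_max_ge[of 1 n A B] * by simp
qed

lemma walk_max_mono:
  assumes "A \<inter> {1..n} = A' \<inter> {1..n}" "B \<inter> {1..n} = B' \<inter> {1..n}"
  shows "walk_max n A B \<le> walk_max (Suc n) A' B'"
  unfolding walk_max_def[of n]
proof (intro Max.boundedI)
  fix x assume "x \<in> (\<lambda>i. real (card (A \<inter> {1..i})) + real (card (B \<inter> {1..i})) - real i) ` {0..n}"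
  then obtain i where i: "i \<le> n" "x = real (card (A \<inter> {1..i})) + real (card (B \<inter> {1..i})) - real i" by auto
  have "A \<inter> {1..i} = A' \<inter> {1..i}" "B \<inter> {1..i} = B' \<inter> {1..i}" using assms i(1) by auto
  then show "x \<le> walk_max (Suc n) A' B'"
    using walk_max_ge[of i "Suc n" A' B'] i by simp
qed auto

text \<open>By inclusion-exclusion the height at i is at most the number of common elements up to i,
  because the union has at most i elements.\<close>

lemma walk_max_le: 
  assumes "finite A"
  shows "walk_max n A B \<le> real (card (A \<inter> B))"
  unfolding walk_max_def
proof (intro Max.boundedI)
  fix x assume "x \<in> (\<lambda>i. real (card (A \<inter> {1..i})) + real (card (B \<inter> {1..i})) - real i) ` {0..n}"
  then obtain i where i: "x = real (card (A \<inter> {1..i})) + real (card (B \<inter> {1..i})) - real i" by auto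
  let ?A = "A \<inter> {1..i}" and ?B = "B \<inter> {1..i}"
  have "card (?A \<union> ?B) \<le> card {1..i}" by (rule card_mono) auto
  moreover have "card (?A \<inter> ?B) \<le> card (A \<inter> B)" by (rule card_mono) (use assms in auto)
  moreover have "card ?A + card ?B = card (?A \<union> ?B) + card (?A \<inter> ?B)"
    by (rule card_Un_Int) auto
  ultimately show "x \<le> real (card (A \<inter> B))" unfolding i by simp
qed auto

lemma HW_eq_walk_max:
  "real (HW n u v) = 2 * real n - real (card (recs n u)) - real (card (recs n v)) + walk_max n (recs n u) (recs n v)"
proof -
  have L: "real (Lam n w (Suc i)) = real n - real i - real (card (recs n w)) + real (card (recs n w \<inter> {1..i}))"
    if "i \<le> n" for w i
  proof -
    have "{j\<in>{Suc i..n}. nonrec w j} \<union> (recs n w - recs n w \<inter> {1..i}) = {Suc i..n}"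
      "{j\<in>{Suc i..n}. nonrec w j} \<inter> (recs n w - recs n w \<inter> {1..i}) = {}"
      by (auto simp: recs_def)
    then have "Lam n w (Suc i) + card (recs n w - recs n w \<inter> {1..i}) = n - i"
      unfolding Lam_def using card_Un_disjoint[of "{j\<in>{Suc i..n}. nonrec w j}" "recs n w - recs n w \<inter> {1..i}"] by simp
    moreover have "card (recs n w - recs n w \<inter> {1..i}) = card (recs n w) - card (recs n w \<inter> {1..i})"
      by (rule card_Diff_subset) auto
    moreover have "card (recs n w \<inter> {1..i}) \<le> card (recs n w)" by (rule card_mono) auto
    ultimately show ?thesis using that by linarith
  qed
  let ?c = "2 * real n - real (card (recs n u)) - real (card (recs n v))"
  have "real (HW n u v) = Max (real ` (\<lambda>i. Lam n u (Suc i) + Lam n v (Suc i) + i) ` {0..n})"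
    unfolding HW_def by (rule mono_Max_commute) (auto simp: mono_def)
  also have "real ` (\<lambda>i. Lam n u (Suc i) + Lam n v (Suc i) + i) ` {0..n}
      = (\<lambda>x. ?c + x) ` (\<lambda>i. real (card (recs n u \<inter> {1..i})) + real (card (recs n v \<inter> {1..i})) - real i) ` {0..n}"
    unfolding image_image by (rule image_cong) (use L in auto)
  also have "Max \<dots> = ?c + walk_max n (recs n u) (recs n v)"
    unfolding walk_max_def by (rule mono_Max_commute[symmetric]) (auto simp: mono_def)
  finally show ?thesis .
qed

definition recE2 :: "nat \<Rightarrow> (nat set \<Rightarrow> nat set \<Rightarrow> 'a::real_normed_field) \<Rightarrow> 'a" where
  "recE2 n F = recE n (\<lambda>A. recE n (F A))"

lemma recE2_mono:
  fixes F :: "nat set \<Rightarrow> nat set \<Rightarrow> real"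
  shows "(\<And>A B. A \<subseteq> {1..n} \<Longrightarrow> B \<subseteq> {1..n} \<Longrightarrow> F A B \<le> G A B) \<Longrightarrow> recE2 n F \<le> recE2 n G"
  unfolding recE2_def by (intro recE_mono) auto

lemma recE2_walk_max_mono: "recE2 n (walk_max n) \<le> recE2 (Suc n) (walk_max (Suc n))"
  unfolding recE2_def by (intro recE_Suc_mono walk_max_mono) auto

lemma sum_inverse_squares_le: "(\<Sum>j=1..n. 1 / (real j)\<^sup>2) \<le> pi\<^sup>2 / 6"
proof -
  have "(\<Sum>j=1..n. 1 / (real j)\<^sup>2) = (\<Sum>j<n. 1 / (real (j + 1))\<^sup>2)"
    using sum.atLeast1_atMost_eq[of "\<lambda>j. 1 / (real j)\<^sup>2" n] by simp
  also have "\<dots> \<le> pi\<^sup>2 / 6"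
    using inverse_squares_sums sum_le_suminf[of "\<lambda>n. 1 / (real (n + 1))\<^sup>2" "{..<n}"]
    by (simp add: sums_iff)
  finally show ?thesis .
qed

text \<open>The expected number of common records is the sum of 1/j^2 over j up to n.\<close>

lemma recE2_walk_max_le: "recE2 n (walk_max n) \<le> pi\<^sup>2 / 6"
proof -
  have "recE2 n (walk_max n) \<le> recE2 n (\<lambda>A B. \<Sum>j=1..n. (if j \<in> A then 1 else 0) * (if j \<in> B then 1 else 0))"
  proof (rule recE2_mono)
    fix A B assume A: "A \<subseteq> {1..n}" "B \<subseteq> {1..n}"
    have "(\<Sum>j=1..n. (if j \<in> A then 1 else 0) * (if j \<in> B then 1 else 0 :: real)) = (\<Sum>j=1..n. if j \<in> A \<inter> B then 1 else 0)"
      by (rule sum.cong) auto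
    also have "\<dots> = real (card ({1..n} \<inter> (A \<inter> B)))"
      by (simp add: sum.If_cases Int_def)
    also have "{1..n} \<inter> (A \<inter> B) = A \<inter> B" using A by auto
    finally show "walk_max n A B \<le> (\<Sum>j=1..n. (if j \<in> A then 1 else 0) * (if j \<in> B then 1 else 0))"
      using walk_max_le[of A n B] A finite_subset by auto
  qed
  also have "\<dots> = (\<Sum>j=1..n. 1 / (real j)\<^sup>2)"
    unfolding recE2_def recE_sum recE_mult_left recE_mult_right recE_mem by (simp add: power2_eq_square)
  also have "\<dots> \<le> pi\<^sup>2 / 6" by (rule sum_inverse_squares_le)
  finally show ?thesis .
qed

lemma one_in_recs: "w \<in> Sn n \<Longrightarrow> 1 \<le> n \<Longrightarrow> 1 \<in> recs n w"
  using Sn_zero_fixed[of w n] by (auto simp: recs_def nonrec_def)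

lemma recE2_walk_max_ge:
  assumes "1 \<le> n"
  shows "1 \<le> recE2 n (walk_max n)"
proof -
  have "1 = recE2 n (\<lambda>A B. 1)" by (simp add: recE2_def)
  also have "\<dots> \<le> recE2 n (walk_max n)"
    unfolding recE2_def recE_def
    by (intro divide_right_mono sum_mono walk_max_ge_1 one_in_recs assms) auto
  finally show ?thesis .
qed

text \<open>The source of the constant c: the means increase with n, and position 1 is always a
  common record, which gives the lower bound.\<close>

lemma recE2_walk_max_limit:
  obtains c where "1 \<le> c" "c \<le> pi\<^sup>2 / 6" "(\<lambda>n. recE2 n (walk_max n)) \<longlonglongrightarrow> c"
proof -
  have "incseq (\<lambda>n. recE2 n (walk_max n))"
    by (rule incseq_SucI) (rule recE2_walk_max_mono)
  then obtain c where c: "(\<lambda>n. recE2 n (walk_max n)) \<longlonglongrightarrow> c"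
    using incseq_convergent[of _ "pi\<^sup>2 / 6"] recE2_walk_max_le by metis
  have "1 \<le> c" by (rule LIMSEQ_le_const[OF c]) (use recE2_walk_max_ge in blast)
  moreover have "c \<le> pi\<^sup>2 / 6" by (rule LIMSEQ_le_const2[OF c]) (use recE2_walk_max_le in blast)
  ultimately show thesis using that c by blast
qed

section \<open>The expectation of the forward stability\<close>

lemma expectation_unif_pair:
  fixes f :: "(nat \<Rightarrow> nat) \<times> (nat \<Rightarrow> nat) \<Rightarrow> 'a :: {banach, second_countable_topology, real_normed_field}"
  shows "measure_pmf.expectation (unif_pair n) f = (\<Sum>u\<in>Sn n. (\<Sum>v\<in>Sn n. f (u, v)) / fact n) / fact n"
proof -
  have ne: "Sn n \<noteq> {}" using id_in_Sn by blast
  have pmf: "pmf (unif_pair n) (u, v) = 1 / (fact n * fact n)" if "u \<in> Sn n" "v \<in> Sn n" for u v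
    unfolding unif_pair_def using that ne by (simp add: pmf_pair card_Sn)
  have "measure_pmf.expectation (unif_pair n) f = (\<Sum>x\<in>Sn n \<times> Sn n. pmf (unif_pair n) x *\<^sub>R f x)"
    by (rule integral_measure_pmf) (use ne in \<open>auto simp: unif_pair_def\<close>)
  also have "\<dots> = (\<Sum>u\<in>Sn n. \<Sum>v\<in>Sn n. pmf (unif_pair n) (u, v) *\<^sub>R f (u, v))"
    by (simp add: sum.cartesian_product case_prod_unfold)
  also have "\<dots> = (\<Sum>u\<in>Sn n. \<Sum>v\<in>Sn n. f (u, v) / fact n / fact n)"
    by (intro sum.cong refl) (simp add: pmf scaleR_conv_of_real)
  finally show ?thesis by (simp add: sum_divide_distrib)
qed

lemma expectation_unif_pair_recs:
  fixes F :: "nat set \<Rightarrow> nat set \<Rightarrow> 'a :: {banach, second_countable_topology, real_normed_field}"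
  shows "measure_pmf.expectation (unif_pair n) (\<lambda>(u, v). F (recs n u) (recs n v)) = recE2 n F"
  unfolding expectation_unif_pair recE2_def recE_def by simp

lemma set_pmf_unif_pair: "set_pmf (unif_pair n) = Sn n \<times> Sn n"
proof -
  have "Sn n \<noteq> {}" using id_in_Sn by blast
  then show ?thesis by (simp add: unif_pair_def)
qed

lemma integrable_unif_pair [simp]:
  fixes f :: "(nat \<Rightarrow> nat) \<times> (nat \<Rightarrow> nat) \<Rightarrow> 'a :: {banach, second_countable_topology}"
  shows "integrable (unif_pair n) f"
  by (rule integrable_measure_pmf_finite) (simp add: set_pmf_unif_pair)

text \<open>The two quantities can differ only if both permutations fix n. That event has
  probability 1/n^2, so the crude bound 2n contributes only 2/n to the expectation.\<close>

lemma HW_diff_FS: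
  assumes "1 \<le> n" "u \<in> Sn n" "v \<in> Sn n"
  shows "\<bar>real (HW n u v) - real (FS u v)\<bar>
     \<le> 2 * real n * ((if n \<in> recs n u then 1 else 0) * (if n \<in> recs n v then 1 else 0))"
proof (cases "u n = n \<and> v n = n")
  case False
  then show ?thesis using FS_eq_HW[OF assms(2,3,1)] by simp
next
  case True
  have rec: "n \<in> recs n w" if w: "w \<in> Sn n" "w n = n" for w
  proof -
    have "\<not> n < w k" if "k < n" for k using Sn_le[OF w(1), of k] that by simp
    then show ?thesis using w(2) assms(1) by (simp add: recs_def nonrec_def)
  qed
  have "FS u v \<le> HW n u v" "HW n u v \<le> 2 * n"
    using FS_le_HW[OF assms(2,3,1)] HW_le by auto
  then have "\<bar>real (HW n u v) - real (FS u v)\<bar> \<le> 2 * real n" by linarith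
  then show ?thesis using rec[OF assms(2)] rec[OF assms(3)] True by simp
qed

lemma expectation_HW_diff_FS:
  assumes "1 \<le> n"
  shows "measure_pmf.expectation (unif_pair n) (\<lambda>(u, v). \<bar>real (HW n u v) - real (FS u v)\<bar>) \<le> 2 / real n"
proof -
  let ?I = "\<lambda>A. if n \<in> A then 1 else 0 :: real"
  have "measure_pmf.expectation (unif_pair n) (\<lambda>(u, v). \<bar>real (HW n u v) - real (FS u v)\<bar>)
      \<le> measure_pmf.expectation (unif_pair n) (\<lambda>(u, v). 2 * real n * (?I (recs n u) * ?I (recs n v)))"
  proof (rule integral_mono_AE)
    show "AE x in unif_pair n. (case x of (u, v) \<Rightarrow> \<bar>real (HW n u v) - real (FS u v)\<bar>)
        \<le> (case x of (u, v) \<Rightarrow> 2 * real n * (?I (recs n u) * ?I (recs n v)))"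
      unfolding AE_measure_pmf_iff set_pmf_unif_pair
    proof clarify
      fix u v assume "u \<in> Sn n" "v \<in> Sn n"
      then show "\<bar>real (HW n u v) - real (FS u v)\<bar> \<le> 2 * real n * (?I (recs n u) * ?I (recs n v))"
        by (rule HW_diff_FS[OF assms])
    qed
  qed simp_all
  also have "\<dots> = 2 * real n * (1 / real n * (1 / real n))"
    unfolding expectation_unif_pair_recs[of n "\<lambda>A B. 2 * real n * (?I A * ?I B)"] recE2_def
      recE_mult_left recE_mult_right recE_mem using assms by simp
  also have "\<dots> = 2 / real n" using assms by (simp add: field_simps)
  finally show ?thesis .
qed

lemma expectation_HW:
  "measure_pmf.expectation (unif_pair n) (\<lambda>(u, v). real (HW n u v)) = 2 * real n - 2 * harm n + recE2 n (walk_max n)"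
proof -
  have "measure_pmf.expectation (unif_pair n) (\<lambda>(u, v). real (HW n u v))
     = recE2 n (\<lambda>A B. 2 * real n - real (card A) - real (card B) + walk_max n A B)"
    unfolding HW_eq_walk_max
    by (rule expectation_unif_pair_recs[of n "\<lambda>A B. 2 * real n - real (card A) - real (card B) + walk_max n A B"])
  also have "\<dots> = 2 * real n - 2 * harm n + recE2 n (walk_max n)"
    unfolding recE2_def by (simp add: recE_add recE_diff recE_card)
  finally show ?thesis .
qed

lemma expectation_FS:
  obtains c where "1 \<le> c" "c \<le> pi\<^sup>2 / 6"
    "(\<lambda>n. measure_pmf.expectation (unif_pair n) (\<lambda>(u, v). real (FS u v))
            - (2 * real n - 2 * ln (real n) - 2 * euler_mascheroni + c)) \<in> o(\<lambda>_. 1)"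
proof -
  let ?E = "\<lambda>n. measure_pmf.expectation (unif_pair n)"
  obtain c where c: "1 \<le> c" "c \<le> pi\<^sup>2 / 6" "(\<lambda>n. recE2 n (walk_max n)) \<longlonglongrightarrow> c"
    using recE2_walk_max_limit by blast
  define r where "r n = ?E n (\<lambda>(u, v). real (FS u v)) - ?E n (\<lambda>(u, v). real (HW n u v))" for n
  have "r \<longlonglongrightarrow> 0"
  proof (rule Lim_null_comparison)
    show "\<forall>\<^sub>F n in sequentially. norm (r n) \<le> 2 / real n"
      using eventually_ge_at_top[of 1]
    proof eventually_elim
      case (elim n)
      have "r n = ?E n (\<lambda>x. (case x of (u, v) \<Rightarrow> real (FS u v)) - (case x of (u, v) \<Rightarrow> real (HW n u v)))"
        unfolding r_def by (rule Bochner_Integration.integral_diff[symmetric]) simp_all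
      then have "norm (r n) \<le> ?E n (\<lambda>x. norm ((case x of (u, v) \<Rightarrow> real (FS u v)) - (case x of (u, v) \<Rightarrow> real (HW n u v))))"
        by (simp only: integral_norm_bound)
      also have "\<dots> = ?E n (\<lambda>(u, v). \<bar>real (HW n u v) - real (FS u v)\<bar>)"
        by (rule Bochner_Integration.integral_cong) (auto simp: abs_minus_commute)
      finally show ?case using expectation_HW_diff_FS[OF elim] by simp
    qed
    show "(\<lambda>n. 2 / real n) \<longlonglongrightarrow> 0" by (rule lim_const_over_n)
  qed
  then have "(\<lambda>n. r n - 2 * ((harm n - ln (real n)) - euler_mascheroni) + (recE2 n (walk_max n) - c)) \<longlonglongrightarrow> 0 - 2 * (euler_mascheroni - euler_mascheroni) + (c - c)"
    by (intro tendsto_intros c euler_mascheroni_LIMSEQ)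
  moreover have "(\<lambda>n. r n - 2 * ((harm n - ln (real n)) - euler_mascheroni) + (recE2 n (walk_max n) - c))
     = (\<lambda>n. ?E n (\<lambda>(u, v). real (FS u v)) - (2 * real n - 2 * ln (real n) - 2 * euler_mascheroni + c))"
    unfolding r_def expectation_HW by (simp add: algebra_simps)
  ultimately have "(\<lambda>n. ?E n (\<lambda>(u, v). real (FS u v)) - (2 * real n - 2 * ln (real n) - 2 * euler_mascheroni + c)) \<longlonglongrightarrow> 0"
    by simp
  then show thesis using that c(1,2) by (simp add: smalloI_tendsto)
qed

subsection \<open>The central limit theorem\<close>

text \<open>A Poisson approximation, uniform in n. All factors lie in the unit disc: 1 + (z-1)/j is
  a convex combination of 1 and z, and z-1 has nonpositive real part. Hence the products differ by
  at most the sum of the factorwise errors, which are of order |z-1|^2/j^2.\<close>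

lemma prod_near_exp_harm:
  fixes z :: complex
  assumes z: "cmod z = 1"
  shows "cmod ((\<Prod>j=1..n. 1 + (z - 1) / of_nat j) - exp ((z - 1) * harm n)) \<le> exp 2 * (cmod (z - 1))\<^sup>2 * (pi\<^sup>2 / 6)"
proof -
  have a2: "cmod (z - 1) \<le> 2" using norm_triangle_ineq4[of z 1] z by simp
  have "exp ((z - 1) * harm n) = (\<Prod>j=1..n. exp ((z - 1) / of_nat j))"
    unfolding harm_def sum_distrib_left by (subst exp_sum) (simp_all add: field_simps)
  then have "cmod ((\<Prod>j=1..n. 1 + (z - 1) / of_nat j) - exp ((z - 1) * harm n))
     = cmod ((\<Prod>j=1..n. 1 + (z - 1) / of_nat j) - (\<Prod>j=1..n. exp ((z - 1) / of_nat j)))" by simp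
  also have "\<dots> \<le> (\<Sum>j=1..n. cmod (1 + (z - 1) / of_nat j - exp ((z - 1) / of_nat j)))"
  proof (rule norm_prod_diff)
    fix j assume j: "j \<in> {1..n}"
    have "1 + (z - 1) / of_nat j = of_real (1 - 1 / real j) + z / of_nat j"
      by (simp add: diff_divide_distrib)
    then have "cmod (1 + (z - 1) / of_nat j) \<le> \<bar>1 - 1 / real j\<bar> + cmod (z / of_nat j)"
      by (metis norm_triangle_ineq norm_of_real)
    also have "\<dots> = 1" using j z by (simp add: norm_divide)
    finally show "cmod (1 + (z - 1) / of_nat j) \<le> 1" .
    have "Re z \<le> 1" using complex_Re_le_cmod[of z] z by simp
    then show "cmod (exp ((z - 1) / of_nat j)) \<le> 1"
      by (simp add: divide_nonpos_nonneg)
  qed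
  also have "\<dots> \<le> (\<Sum>j=1..n. exp 2 * (cmod (z - 1))\<^sup>2 * (1 / (real j)\<^sup>2))"
  proof (rule sum_mono)
    fix j assume j: "j \<in> {1..n}"
    let ?x = "(z - 1) / of_nat j"
    have nx: "cmod ?x = cmod (z - 1) / real j" by (simp add: norm_divide)
    have "cmod ?x \<le> 2" using j a2 unfolding nx by (simp add: divide_le_eq)
    then have "exp \<bar>Re ?x\<bar> \<le> exp 2" using abs_Re_le_cmod[of ?x] by (simp only: exp_le_cancel_iff)
    have "cmod (1 + ?x - exp ?x) = cmod (exp ?x - (\<Sum>k\<le>1. ?x ^ k / fact k))"
      by (simp add: norm_minus_commute)
    also have "\<dots> \<le> exp \<bar>Re ?x\<bar> * (cmod ?x)\<^sup>2"
      using Taylor_exp[of ?x 1] by (simp add: power2_eq_square)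
    also have "\<dots> \<le> exp 2 * (cmod ?x)\<^sup>2"
      using \<open>exp \<bar>Re ?x\<bar> \<le> exp 2\<close> by (intro mult_right_mono) auto
    finally show "cmod (1 + ?x - exp ?x) \<le> exp 2 * (cmod (z - 1))\<^sup>2 * (1 / (real j)\<^sup>2)"
      unfolding nx by (simp add: power_divide)
  qed
  also have "\<dots> = exp 2 * (cmod (z - 1))\<^sup>2 * (\<Sum>j=1..n. 1 / (real j)\<^sup>2)"
    by (simp add: sum_distrib_left)
  also have "\<dots> \<le> exp 2 * (cmod (z - 1))\<^sup>2 * (pi\<^sup>2 / 6)"
    by (intro mult_left_mono sum_inverse_squares_le) auto
  finally show ?thesis .
qed

lemma cmod_iexp_diff_le: "cmod (iexp x - iexp y) \<le> \<bar>x - y\<bar>"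
proof -
  have "iexp y * iexp (x - y) = iexp x"
    unfolding exp_add[symmetric] by (simp add: algebra_simps)
  then have "iexp x - iexp y = iexp y * (iexp (x - y) - 1)"
    by (simp add: right_diff_distrib)
  then have "cmod (iexp x - iexp y) = cmod (iexp (x - y) - 1)"
    by (simp add: norm_mult)
  then show ?thesis using iexp_approx1[of "x - y" 0] by simp
qed

lemma recE2_iexp:
  "recE2 n (\<lambda>A B. iexp (c - \<theta> * real (card A) - \<theta> * real (card B)))
    = iexp c * (\<Prod>j=1..n. 1 + (iexp (- \<theta>) - 1) / of_nat j)\<^sup>2"
proof -
  have "iexp (c - \<theta> * real a - \<theta> * real b) = iexp c * (iexp (- \<theta>) ^ a * iexp (- \<theta>) ^ b)" for a b
    by (simp add: exp_of_nat_mult[symmetric] exp_add[symmetric] algebra_simps)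
  then show ?thesis
    unfolding recE2_def by (simp add: recE_mult_left recE_mult_right recE_power_card power2_eq_square)
qed

text \<open>The left side is \<open>w n * (P n)\<^sup>2\<close>, and \<open>P\<close> is replaced by
  the exponential \<open>Q\<close>. The sign in \<open>\<theta>\<close> reflects that the record
  counts enter negatively.\<close>

lemma recE2_iexp_limit:
  "(\<lambda>n. recE2 n (\<lambda>A B. iexp (t * ((2 * ln (real n) - real (card A) - real (card B)) / sqrt (2 * ln (real n))))))
     \<longlonglongrightarrow> of_real (exp (- (t\<^sup>2) / 2))"
proof -
  define L where "L n = ln (real n)" for n
  define \<theta> where "\<theta> n = - t / sqrt (2 * L n)" for n
  define z where "z n = iexp (\<theta> n)" for n
  define h where "h n = (harm n :: real)" for n
  define P where "P n = (\<Prod>j=1..n. 1 + (z n - 1) / of_nat j)" for n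
  define Q where "Q n = exp ((z n - 1) * harm n)" for n
  define w where "w n = iexp (- \<theta> n * (2 * L n))" for n
  have eq: "recE2 n (\<lambda>A B. iexp (t * ((2 * ln (real n) - real (card A) - real (card B)) / sqrt (2 * ln (real n)))))
      = w n * (P n)\<^sup>2" for n
  proof -
    have "t * ((2 * ln (real n) - x - y) / sqrt (2 * ln (real n)))
       = - \<theta> n * (2 * L n) - (- \<theta> n) * x - (- \<theta> n) * y" for x y
      unfolding \<theta>_def L_def by (simp add: diff_divide_distrib right_diff_distrib)
    then show ?thesis
      unfolding w_def P_def z_def using recE2_iexp[of n "- \<theta> n * (2 * L n)" "- \<theta> n"] by simp
  qed
  have \<theta>0: "\<theta> \<longlonglongrightarrow> 0" unfolding \<theta>_def L_def by real_asymp
  have L0: "(\<lambda>n. 1 / L n) \<longlonglongrightarrow> 0" unfolding L_def by real_asymp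
  have hL: "(\<lambda>n. h n - L n) \<longlonglongrightarrow> euler_mascheroni"
    unfolding h_def L_def by (rule euler_mascheroni_LIMSEQ)
  have Lpos: "\<forall>\<^sub>F n in sequentially. 0 < L n"
    using eventually_ge_at_top[of 2] by eventually_elim (simp add: L_def)
  \<comment> \<open>Here \<open>\<theta>\<close> squared is t^2 / (2 L), while h and L differ by a
    bounded amount.\<close>
  have h\<theta>: "(\<lambda>n. h n * (\<theta> n)\<^sup>2) \<longlonglongrightarrow> t\<^sup>2 / 2"
  proof -
    have "(\<lambda>n. t\<^sup>2 / 2 * ((h n - L n) * (1 / L n) + 1)) \<longlonglongrightarrow> t\<^sup>2 / 2 * (euler_mascheroni * 0 + 1)"
      by (intro tendsto_intros hL L0)
    moreover have "\<forall>\<^sub>F n in sequentially. t\<^sup>2 / 2 * ((h n - L n) * (1 / L n) + 1) = h n * (\<theta> n)\<^sup>2"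
      using Lpos by eventually_elim (simp add: \<theta>_def power_divide field_simps)
    ultimately show ?thesis by (simp add: tendsto_cong)
  qed
  have cmodz: "cmod (z n) = 1" for n unfolding z_def by simp
  have z1: "cmod (z n - 1) \<le> \<bar>\<theta> n\<bar>" for n
    using cmod_iexp_diff_le[of "\<theta> n" 0] by (simp add: z_def)
  have PQ: "(\<lambda>n. P n - Q n) \<longlonglongrightarrow> 0"
  proof (rule Lim_null_comparison)
    show "\<forall>\<^sub>F n in sequentially. norm (P n - Q n) \<le> exp 2 * (\<theta> n)\<^sup>2 * (pi\<^sup>2 / 6)"
    proof (intro always_eventually allI)
      fix n
      have "norm (P n - Q n) \<le> exp 2 * (cmod (z n - 1))\<^sup>2 * (pi\<^sup>2 / 6)"
        unfolding P_def Q_def by (rule prod_near_exp_harm[OF cmodz])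
      also have "\<dots> \<le> exp 2 * (\<theta> n)\<^sup>2 * (pi\<^sup>2 / 6)"
        using power_mono[OF z1, of n 2] by (intro mult_right_mono mult_left_mono) auto
      finally show "norm (P n - Q n) \<le> exp 2 * (\<theta> n)\<^sup>2 * (pi\<^sup>2 / 6)" .
    qed
    have "(\<lambda>n. exp 2 * (\<theta> n)\<^sup>2 * (pi\<^sup>2 / 6)) \<longlonglongrightarrow> exp 2 * 0\<^sup>2 * (pi\<^sup>2 / 6)"
      by (intro tendsto_intros \<theta>0)
    then show "(\<lambda>n. exp 2 * (\<theta> n)\<^sup>2 * (pi\<^sup>2 / 6)) \<longlonglongrightarrow> 0" by simp
  qed
  \<comment> \<open>The third-order remainder of the exponential; its product with h vanishes in the
    limit because h times \<open>\<theta>\<close> squared stays bounded.\<close>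
  define \<epsilon> where "\<epsilon> n = z n - 1 - \<i> * \<theta> n + of_real ((\<theta> n)\<^sup>2 / 2)" for n
  have \<epsilon>: "cmod (\<epsilon> n) \<le> \<bar>\<theta> n\<bar> ^ 3 / 6" for n
  proof -
    have "\<epsilon> n = z n - (\<Sum>k\<le>2. (\<i> * \<theta> n) ^ k / fact k)"
      by (simp add: \<epsilon>_def numeral_2_eq_2 power_mult_distrib)
    moreover have "\<bar>\<theta> n\<bar> ^ 3 / 6 = \<bar>\<theta> n\<bar> ^ Suc 2 / fact (Suc 2)"
      by (simp add: eval_nat_numeral)
    ultimately show ?thesis
      using iexp_approx1[of "\<theta> n" 2] by (simp only: z_def)
  qed
  have h\<epsilon>: "(\<lambda>n. 2 * of_real (h n) * \<epsilon> n) \<longlonglongrightarrow> 0"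
  proof (rule Lim_null_comparison)
    show "\<forall>\<^sub>F n in sequentially. norm (2 * of_real (h n) * \<epsilon> n) \<le> h n * (\<theta> n)\<^sup>2 * \<bar>\<theta> n\<bar> / 3"
    proof (intro always_eventually allI)
      fix n
      have h0: "0 \<le> h n" unfolding h_def by (rule harm_nonneg)
      then have "norm (2 * of_real (h n) * \<epsilon> n) \<le> 2 * h n * (\<bar>\<theta> n\<bar> ^ 3 / 6)"
        using mult_left_mono[OF \<epsilon>[of n], of "2 * h n"] by (simp add: norm_mult)
      also have "\<dots> = h n * (\<theta> n)\<^sup>2 * \<bar>\<theta> n\<bar> / 3"
        by (simp add: power3_eq_cube power2_eq_square abs_mult_self_eq)
      finally show "norm (2 * of_real (h n) * \<epsilon> n) \<le> h n * (\<theta> n)\<^sup>2 * \<bar>\<theta> n\<bar> / 3" .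
    qed
    have "(\<lambda>n. h n * (\<theta> n)\<^sup>2 * \<bar>\<theta> n\<bar> / 3) \<longlonglongrightarrow> t\<^sup>2 / 2 * \<bar>0\<bar> / 3"
      by (intro tendsto_intros h\<theta> \<theta>0) simp
    then show "(\<lambda>n. h n * (\<theta> n)\<^sup>2 * \<bar>\<theta> n\<bar> / 3) \<longlonglongrightarrow> 0" by simp
  qed
  have wQ: "(\<lambda>n. w n * (Q n)\<^sup>2) \<longlonglongrightarrow> exp (of_real (- (t\<^sup>2) / 2))"
  proof -
    \<comment> \<open>The exponent of w Q^2, arranged so that the divergent linear terms meet in h -
      L, which converges and is multiplied by a null sequence.\<close>
    have "(\<lambda>n. 2 * of_real (h n) * \<epsilon> n - of_real (h n * (\<theta> n)\<^sup>2) + 2 * \<i> * of_real (\<theta> n * (h n - L n)))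
        \<longlonglongrightarrow> 0 - of_real (t\<^sup>2 / 2) + 2 * \<i> * of_real (0 * euler_mascheroni)"
      by (intro tendsto_intros h\<epsilon> h\<theta> \<theta>0 hL)
    then have "(\<lambda>n. exp (2 * of_real (h n) * \<epsilon> n - of_real (h n * (\<theta> n)\<^sup>2) + 2 * \<i> * of_real (\<theta> n * (h n - L n))))
        \<longlonglongrightarrow> exp (0 - of_real (t\<^sup>2 / 2) + 2 * \<i> * of_real (0 * euler_mascheroni))"
      by (rule tendsto_exp)
    moreover have "exp (2 * of_real (h n) * \<epsilon> n - of_real (h n * (\<theta> n)\<^sup>2) + 2 * \<i> * of_real (\<theta> n * (h n - L n)))
        = w n * (Q n)\<^sup>2" for n
    proof -
      have harm: "harm n = complex_of_real (h n)" unfolding h_def by (rule of_real_harm[symmetric])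
      have "w n * (Q n)\<^sup>2 = exp (\<i> * of_real (- \<theta> n * (2 * L n)) + 2 * ((z n - 1) * of_real (h n)))"
        unfolding w_def Q_def harm exp_double[symmetric] exp_add[symmetric] ..
      also have "\<i> * of_real (- \<theta> n * (2 * L n)) + 2 * ((z n - 1) * of_real (h n))
         = 2 * of_real (h n) * \<epsilon> n - of_real (h n * (\<theta> n)\<^sup>2) + 2 * \<i> * of_real (\<theta> n * (h n - L n))"
        unfolding \<epsilon>_def by (simp add: algebra_simps)
      finally show ?thesis by simp
    qed
    ultimately show ?thesis by simp
  qed
  have diff: "(\<lambda>n. w n * ((P n)\<^sup>2 - (Q n)\<^sup>2)) \<longlonglongrightarrow> 0"
  proof (rule Lim_null_comparison)
    show "\<forall>\<^sub>F n in sequentially. norm (w n * ((P n)\<^sup>2 - (Q n)\<^sup>2)) \<le> norm (P n - Q n) * (norm (P n - Q n) + 2 * norm (Q n))"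
    proof (intro always_eventually allI)
      fix n
      have "(P n)\<^sup>2 - (Q n)\<^sup>2 = (P n - Q n) * ((P n - Q n) + 2 * Q n)"
        by (simp add: power2_eq_square algebra_simps)
      moreover have "norm ((P n - Q n) + 2 * Q n) \<le> norm (P n - Q n) + 2 * norm (Q n)"
        using norm_triangle_ineq[of "P n - Q n" "2 * Q n"] by (simp add: norm_mult)
      moreover have "norm (w n) = 1" unfolding w_def by simp
      ultimately show "norm (w n * ((P n)\<^sup>2 - (Q n)\<^sup>2)) \<le> norm (P n - Q n) * (norm (P n - Q n) + 2 * norm (Q n))"
        by (simp only: norm_mult mult_1_left) (intro mult_left_mono norm_ge_zero)
    qed
    have Q1: "norm (Q n) \<le> 1" for n
    proof -
      have "Re (z n) \<le> 1" using complex_Re_le_cmod[of "z n"] cmodz by simp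
      moreover have "harm n = complex_of_real (h n)" "0 \<le> h n"
        unfolding h_def by (simp_all add: of_real_harm harm_nonneg)
      ultimately show ?thesis unfolding Q_def by (simp add: mult_nonpos_nonneg)
    qed
    show "(\<lambda>n. norm (P n - Q n) * (norm (P n - Q n) + 2 * norm (Q n))) \<longlonglongrightarrow> 0"
    proof (rule Lim_null_comparison)
      show "\<forall>\<^sub>F n in sequentially. norm (norm (P n - Q n) * (norm (P n - Q n) + 2 * norm (Q n)))
           \<le> norm (P n - Q n) * (norm (P n - Q n) + 2)"
        using Q1 by (intro always_eventually allI) (auto simp: abs_mult intro!: mult_left_mono)
      have "(\<lambda>n. norm (P n - Q n) * (norm (P n - Q n) + 2)) \<longlonglongrightarrow> norm (0::complex) * (norm (0::complex) + 2)"
        by (intro tendsto_intros PQ)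
      then show "(\<lambda>n. norm (P n - Q n) * (norm (P n - Q n) + 2)) \<longlonglongrightarrow> 0" by simp
    qed
  qed
  have "(\<lambda>n. w n * (Q n)\<^sup>2 + w n * ((P n)\<^sup>2 - (Q n)\<^sup>2)) \<longlonglongrightarrow> of_real (exp (- (t\<^sup>2) / 2)) + 0"
    unfolding exp_of_real[symmetric] by (intro tendsto_add wQ diff)
  moreover have "w n * (Q n)\<^sup>2 + w n * ((P n)\<^sup>2 - (Q n)\<^sup>2) = w n * (P n)\<^sup>2" for n
    by (simp add: algebra_simps)
  ultimately show ?thesis unfolding eq by (simp only: add_0_right)
qed

text \<open>Replacing the forward stability by 2n minus both record counts costs a bounded amount in
  mean, namely the maximum of the walk and the error where both permutations fix n. Division by
  sqrt(2 ln n) makes it negligible.\<close>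

lemma expectation_deviation_le:
  assumes "1 \<le> n"
  shows "measure_pmf.expectation (unif_pair n)
      (\<lambda>(u, v). \<bar>real (FS u v) - (2 * real n - real (card (recs n u)) - real (card (recs n v)))\<bar>) \<le> 2 / real n + pi\<^sup>2 / 6"
proof -
  let ?E = "measure_pmf.expectation (unif_pair n)"
  have "?E (\<lambda>(u, v). \<bar>real (FS u v) - (2 * real n - real (card (recs n u)) - real (card (recs n v)))\<bar>)
     \<le> ?E (\<lambda>x. (case x of (u, v) \<Rightarrow> \<bar>real (HW n u v) - real (FS u v)\<bar>) + (case x of (u, v) \<Rightarrow> walk_max n (recs n u) (recs n v)))"
  proof (rule integral_mono)
    fix x
    show "(case x of (u, v) \<Rightarrow> \<bar>real (FS u v) - (2 * real n - real (card (recs n u)) - real (card (recs n v)))\<bar>)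
       \<le> (case x of (u, v) \<Rightarrow> \<bar>real (HW n u v) - real (FS u v)\<bar>) + (case x of (u, v) \<Rightarrow> walk_max n (recs n u) (recs n v))"
      using walk_max_nonneg[of n "recs n (fst x)" "recs n (snd x)"] HW_eq_walk_max[of n "fst x" "snd x"]
      by (auto simp: case_prod_unfold)
  qed simp_all
  also have "\<dots> = ?E (\<lambda>(u, v). \<bar>real (HW n u v) - real (FS u v)\<bar>) + recE2 n (walk_max n)"
    by (subst Bochner_Integration.integral_add) (simp_all add: expectation_unif_pair_recs)
  also have "\<dots> \<le> 2 / real n + pi\<^sup>2 / 6"
    by (intro add_mono expectation_HW_diff_FS recE2_walk_max_le assms)
  finally show ?thesis .
qed

lemma FS_weak_conv:
  "weak_conv_m
        (\<lambda>n. distr (measure_pmf (unif_pair n)) borel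
           (\<lambda>(u, v). (real (FS u v) - (2 * real n - 2 * ln (real n))) / sqrt (2 * ln (real n))))
        std_normal_distribution"
proof (rule levy_continuity)
  let ?Z = "\<lambda>n (u, v). (real (FS u v) - (2 * real n - 2 * ln (real n))) / sqrt (2 * ln (real n))"
  show "real_distribution (distr (measure_pmf (unif_pair n)) borel (?Z n))" for n
    by (rule prob_space.real_distribution_distr) (auto simp: measure_pmf.prob_space_axioms)
  show "real_distribution std_normal_distribution" by (rule real_dist_normal_dist)
  fix t
  let ?E = "\<lambda>n. measure_pmf.expectation (unif_pair n)"
  let ?Y = "\<lambda>n A B. (2 * ln (real n) - real (card A) - real (card B)) / sqrt (2 * ln (real n))"
  have char: "char (distr (measure_pmf (unif_pair n)) borel (?Z n)) t = ?E n (\<lambda>x. iexp (t * ?Z n x))" for n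
    unfolding char_def by (subst integral_distr) auto
  \<comment> \<open>Since \<open>iexp\<close> is 1-Lipschitz, the characteristic functions differ by
    at most |t| times the mean distance of the two normalised variables.\<close>
  have "(\<lambda>n. ?E n (\<lambda>x. iexp (t * ?Z n x)) - recE2 n (\<lambda>A B. iexp (t * ?Y n A B))) \<longlonglongrightarrow> 0"
  proof (rule Lim_null_comparison)
    show "\<forall>\<^sub>F n in sequentially. norm (?E n (\<lambda>x. iexp (t * ?Z n x)) - recE2 n (\<lambda>A B. iexp (t * ?Y n A B)))
       \<le> \<bar>t\<bar> * (2 / real n + pi\<^sup>2 / 6) / sqrt (2 * ln (real n))"
      \<comment> \<open>From n = 2 on the normalising square root is positive.\<close>
      using eventually_ge_at_top[of 2]
    proof eventually_elim
      case (elim n)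
      define s where "s = sqrt (2 * ln (real n))"
      have s: "0 < s" using elim by (simp add: s_def)
      let ?W = "\<lambda>(u, v). iexp (t * ?Y n (recs n u) (recs n v))"
      let ?D = "\<lambda>(u, v). \<bar>real (FS u v) - (2 * real n - real (card (recs n u)) - real (card (recs n v)))\<bar>"
      have "?E n (\<lambda>x. iexp (t * ?Z n x)) - recE2 n (\<lambda>A B. iexp (t * ?Y n A B))
         = ?E n (\<lambda>x. iexp (t * ?Z n x) - ?W x)"
        unfolding expectation_unif_pair_recs[symmetric] by (rule Bochner_Integration.integral_diff[symmetric]) simp_all
      then have "norm (?E n (\<lambda>x. iexp (t * ?Z n x)) - recE2 n (\<lambda>A B. iexp (t * ?Y n A B)))
         \<le> ?E n (\<lambda>x. norm (iexp (t * ?Z n x) - ?W x))"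
        by (simp only: integral_norm_bound)
      also have "\<dots> \<le> ?E n (\<lambda>x. \<bar>t\<bar> / s * ?D x)"
      proof (rule integral_mono)
        fix x :: "(nat \<Rightarrow> nat) \<times> (nat \<Rightarrow> nat)"
        obtain u v where x: "x = (u, v)" by (cases x)
        have "norm (iexp (t * ?Z n x) - ?W x) \<le> \<bar>t * ?Z n x - t * ?Y n (recs n u) (recs n v)\<bar>"
          unfolding x prod.case by (rule cmod_iexp_diff_le)
        also have "t * ?Z n x - t * ?Y n (recs n u) (recs n v)
           = t / s * (real (FS u v) - (2 * real n - real (card (recs n u)) - real (card (recs n v))))"
          unfolding x s_def[symmetric] using s by (simp add: field_simps)
        also have "\<bar>\<dots>\<bar> = \<bar>t\<bar> / s * ?D x"
          using s by (simp add: x abs_mult)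
        finally show "norm (iexp (t * ?Z n x) - ?W x) \<le> \<bar>t\<bar> / s * ?D x" .
      qed simp_all
      also have "\<dots> = \<bar>t\<bar> / s * ?E n ?D" by simp
      also have "\<dots> \<le> \<bar>t\<bar> / s * (2 / real n + pi\<^sup>2 / 6)"
        using expectation_deviation_le[of n] elim s by (intro mult_left_mono) auto
      finally show ?case by (simp add: s_def)
    qed
    show "(\<lambda>n. \<bar>t\<bar> * (2 / real n + pi\<^sup>2 / 6) / sqrt (2 * ln (real n))) \<longlonglongrightarrow> 0"
      by real_asymp
  qed
  from tendsto_add[OF this recE2_iexp_limit[of t]]
  show "(\<lambda>n. char (distr (measure_pmf (unif_pair n)) borel (?Z n)) t) \<longlonglongrightarrow> char std_normal_distribution t"
    unfolding char by (simp add: char_std_normal_distribution)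
qed

theorem theorem1p2:
  shows "(\<exists>c::real. 1 \<le> c \<and> c \<le> pi\<^sup>2 / 6 \<and>
      (\<lambda>n. measure_pmf.expectation (unif_pair n) (\<lambda>(u, v). real (FS u v))
            - (2 * real n - 2 * ln (real n) - 2 * euler_mascheroni + c)) \<in> o(\<lambda>_. 1))
    \<and> weak_conv_m
        (\<lambda>n. distr (measure_pmf (unif_pair n)) borel
           (\<lambda>(u, v). (real (FS u v) - (2 * real n - 2 * ln (real n))) / sqrt (2 * ln (real n))))
        std_normal_distribution"
proof (rule conjI[OF _ FS_weak_conv], rule expectation_FS)
  fix c :: real
  assume "1 \<le> c" "c \<le> pi\<^sup>2 / 6"
    "(\<lambda>n. measure_pmf.expectation (unif_pair n) (\<lambda>(u, v). real (FS u v))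
            - (2 * real n - 2 * ln (real n) - 2 * euler_mascheroni + c)) \<in> o(\<lambda>_. 1)"
  then show "\<exists>c::real. 1 \<le> c \<and> c \<le> pi\<^sup>2 / 6 \<and>
      (\<lambda>n. measure_pmf.expectation (unif_pair n) (\<lambda>(u, v). real (FS u v))
            - (2 * real n - 2 * ln (real n) - 2 * euler_mascheroni + c)) \<in> o(\<lambda>_. 1)"
    by (intro exI conjI)
qed

end
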